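(* Let $\Gamma$ be a regular antipodal subgroup of $\mathrm{SL}_3(\mathbb R)$ whose limit set is a topological circle. If $\Gamma\cap H$ is Zariski-dense in $H$ for some reducible copy $H$ of $\mathrm{SL}_2(\mathbb R)$ in $\mathrm{SL}_3(\mathbb R)$, then $\Gamma$ has a dense orbit in $\mathbb{RP}^2$.
   Context: For $g\in\mathrm{SL}_3(\mathbb R)$ let $\sigma_1(g)\ge\sigma_2(g)\ge\sigma_3(g)$ be its singular values. A discrete subgroup $\Gamma<\mathrm{SL}_3(\mathbb R)$ is regular if for every sequence $(\gamma_j)$ of pairwise distinct elements of $\Gamma$ one has $\sigma_i(\gamma_j)/\sigma_{i+1}(\gamma_j)\to\infty$ for $i=1,2$. Let $\mathcal F(\mathbb R^3)$ be the space of complete flags $V_1\subset V_2$ of linear subspaces of $\mathbb R^3$. The limit set of a regular $\Gamma$ is the set of all limits in $\mathcal F(\mathbb R^3)$ of sequences of flags $k_j(\mathrm{span}\{e_1\}\subset\mathrm{span}\{e_1,e_2\})$, where $\gamma_j=k_j\,\mathrm{diag}(\sigma_1(\gamma_j),\sigma_2(\gamma_j),\sigma_3(\gamma_j))\,k_j'$, $k_j,k_j'\in\mathrm{O}(3)$, and $(\gamma_j)$ is a sequence of pairwise distinct elements of $\Gamma$. A regular subgroup $\Gamma$ is antipodal if any two distinct flags $(V_1\subset V_2)$, $(V_1'\subset V_2')$ in its limit set are transverse: $V_1\not\subset V_2'$ and $V_1'\not\subset V_2$. A reducible copy of $\mathrm{SL}_2(\mathbb R)$ in $\mathrm{SL}_3(\mathbb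 R)$ is a conjugate of the block-diagonal subgroup $\left\{\begin{pmatrix} g&0\\0&1\end{pmatrix}:g\in\mathrm{SL}_2(\mathbb R)\right\}$. "$\Gamma\cap H$ is Zariski-dense in $H$" means that the Zariski closure of $\Gamma\cap H$ is $H$. *)

theory Defs
  imports
    "HOL-Analysis.Analysis"
    "HOL-Algebra.Group"
    "HOL-Computational_Algebra.Polynomial"
begin

section \<open>The group and its discrete subgroups\<close>

definition SL3 :: "(real^3^3) monoid" where
  "SL3 = \<lparr>carrier = {A. det A = 1}, mult = (**), one = mat 1\<rparr>"

lemma group_SL3: "group SL3"
proof (rule groupI)
  fix A assume "A \<in> carrier SL3"
  then have A: "det A = 1" by (simp add: SL3_def)
  then have "invertible A" by (simp add: invertible_det_nz)
  then obtain B where B: "A ** B = mat 1" "B ** A = mat 1"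
    unfolding invertible_def by blast
  have "det B = 1" using arg_cong[OF B(1), of det] A by (simp add: det_mul)
  with B show "\<exists>y\<in>carrier SL3. y \<otimes>\<^bsub>SL3\<^esub> A = \<one>\<^bsub>SL3\<^esub>"
    by (auto simp: SL3_def)
qed (auto simp: SL3_def det_mul matrix_mul_assoc)

definition discrete_subgroup :: "(real^3^3) set \<Rightarrow> bool" where
  "discrete_subgroup \<Gamma> \<longleftrightarrow> subgroup \<Gamma> SL3 \<and> discrete \<Gamma>"


section \<open>Singular values\<close>

definition charpoly :: "real^'n^'n \<Rightarrow> real poly" where
  "charpoly A = det (mat [:0, 1:] - (\<chi> i j. [:A $ i $ j:]))"

text \<open>
  The square roots of the eigenvalues of \<open>g\<^sup>T g\<close>, with algebraic multiplicity, in decreasing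
  order. As \<open>g\<^sup>T g\<close> is symmetric and positive semidefinite, there are exactly three of them, and
  \<open>singular_value i g\<close> is meaningful for \<open>i = 1, 2, 3\<close>.
\<close>
definition singular_values :: "real^3^3 \<Rightarrow> real list" where
  "singular_values g =
     rev (sorted_list_of_multiset (image_mset sqrt (proots (charpoly (transpose g ** g)))))"

lemma poly_charpoly:
  fixes A :: "real^'n^'n"
  shows "poly (charpoly A) x = det (mat x - A)"
  unfolding charpoly_def det_def
  by (auto simp: poly_sum poly_prod mat_def sign_def intro!: sum.cong prod.cong)

lemma singular_values_eqI:
  fixes k k' :: "real^3^3"
  assumes k: "orthogonal_matrix k" and k': "orthogonal_matrix k'"
    and abc: "a \<ge> b" "b \<ge> c" "c \<ge> 0"
    and g: "g = k ** vector [vector [a, 0, 0], vector [0, b, 0], vector [0, 0, c]] ** k'"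
  shows "singular_values g = [a, b, c]"
proof -
  define D :: "real^3^3" where "D = vector [vector [a, 0, 0], vector [0, b, 0], vector [0, 0, c]]"
  have *: "transpose k ** k = mat 1" "transpose k' ** k' = mat 1"
    using k k' by (simp_all add: orthogonal_matrix)
  have "transpose g ** g = transpose k' ** transpose D ** (transpose k ** k) ** D ** k'"
    by (simp add: g D_def[symmetric] matrix_transpose_mul matrix_mul_assoc)
  also have "\<dots> = transpose k' ** (transpose D ** D) ** k'"
    by (simp add: * matrix_mul_assoc)
  finally have gg: "transpose g ** g = transpose k' ** (transpose D ** D) ** k'" .
  have "poly (charpoly (transpose g ** g)) x = poly ([:- a\<^sup>2, 1:] * [:- b\<^sup>2, 1:] * [:- c\<^sup>2, 1:]) x" for x
  proof -
    have sc: "mat x ** M = x *\<^sub>R M" "M ** mat x = x *\<^sub>R M" for M :: "real^3^3"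
      by (simp_all add: vec_eq_iff matrix_matrix_mult_def mat_def if_distrib if_distribR
          sum.delta cong: if_cong)
    have "transpose k' ** mat x ** k' = mat x"
      using sc *(2) by (metis matrix_mul_assoc matrix_mul_rid matrix_mul_lid)
    moreover have "(M - N) ** P = M ** P - N ** P" "P ** (M - N) = P ** M - P ** N"
      for M N P :: "real^3^3"
      by (simp_all add: vec_eq_iff matrix_matrix_mult_def algebra_simps sum_subtractf)
    ultimately have "mat x - transpose g ** g = transpose k' ** (mat x - transpose D ** D) ** k'"
      by (simp add: gg)
    then have "det (mat x - transpose g ** g) = det (transpose k' ** k') * det (mat x - transpose D ** D)"
      by (simp add: det_mul)
    also have "det (transpose k' ** k') = 1"
      by (simp only: *(2) det_I)
    also have "1 * det (mat x - transpose D ** D) = (x - a\<^sup>2) * (x - b\<^sup>2) * (x - c\<^sup>2)"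
      by (simp add: * det_3 D_def mat_def matrix_matrix_mult_def transpose_def sum_3 power2_eq_square)
    finally show ?thesis by (simp add: poly_charpoly algebra_simps)
  qed
  then have "charpoly (transpose g ** g) = [:- a\<^sup>2, 1:] * [:- b\<^sup>2, 1:] * [:- c\<^sup>2, 1:]"
    by (intro poly_eq_poly_eq_iff[THEN iffD1] ext)
  moreover have "proots (p * q * r) = proots p + proots q + proots r"
    if "p \<noteq> 0" "q \<noteq> 0" "r \<noteq> 0" for p q r :: "real poly"
    using that by (simp add: proots_mult)
  ultimately have "proots (charpoly (transpose g ** g)) =
      proots [:- a\<^sup>2, 1:] + proots [:- b\<^sup>2, 1:] + proots [:- c\<^sup>2, 1:]"
    by (metis one_neq_zero pCons_eq_0_iff)
  then have "proots (charpoly (transpose g ** g)) = {#a\<^sup>2, b\<^sup>2, c\<^sup>2#}"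
    by simp
  with abc show ?thesis
    by (simp add: singular_values_def insort_key_def)
qed

definition singular_value :: "nat \<Rightarrow> real^3^3 \<Rightarrow> real" where
  "singular_value i g = singular_values g ! (i - 1)"

definition singular_diag :: "real^3^3 \<Rightarrow> real^3^3" where
  "singular_diag g =
     vector [vector [singular_value 1 g, 0, 0],
             vector [0, singular_value 2 g, 0],
             vector [0, 0, singular_value 3 g]]"

definition regular_subgroup :: "(real^3^3) set \<Rightarrow> bool" where
  "regular_subgroup \<Gamma> \<longleftrightarrow> discrete_subgroup \<Gamma> \<and>
     (\<forall>\<gamma> :: nat \<Rightarrow> real^3^3. range \<gamma> \<subseteq> \<Gamma> \<and> inj \<gamma> \<longrightarrow>
        (\<forall>i\<in>{1, 2}. filterlim (\<lambda>j. singular_value i (\<gamma> j) / singular_value (i + 1) (\<gamma> j))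
                       at_top sequentially))"


section \<open>Quotient topologies\<close>

definition quotient_topology :: "'a topology \<Rightarrow> ('a \<Rightarrow> 'b) \<Rightarrow> 'b topology" where
  "quotient_topology X f =
     topology (\<lambda>U. U \<subseteq> f ` topspace X \<and> openin X {x \<in> topspace X. f x \<in> U})"

lemma openin_quotient_topology:
  "openin (quotient_topology X f) U \<longleftrightarrow>
     U \<subseteq> f ` topspace X \<and> openin X {x \<in> topspace X. f x \<in> U}"
proof -
  have "istopology (\<lambda>U. U \<subseteq> f ` topspace X \<and> openin X {x \<in> topspace X. f x \<in> U})"
    unfolding istopology_def
  proof (intro conjI allI impI)
    fix S T
    assume "S \<subseteq> f ` topspace X \<and> openin X {x \<in> topspace X. f x \<in> S}"
      and "T \<subseteq> f ` topspace X \<and> openin X {x \<in> topspace X. f x \<in> T}"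
    moreover have "{x \<in> topspace X. f x \<in> S \<inter> T} =
        {x \<in> topspace X. f x \<in> S} \<inter> {x \<in> topspace X. f x \<in> T}" by auto
    ultimately show "openin X {x \<in> topspace X. f x \<in> S \<inter> T}" and "S \<inter> T \<subseteq> f ` topspace X"
      by auto
  next
    fix \<K> assume *: "\<forall>K\<in>\<K>. K \<subseteq> f ` topspace X \<and> openin X {x \<in> topspace X. f x \<in> K}"
    have "{x \<in> topspace X. f x \<in> \<Union>\<K>} = (\<Union>K\<in>\<K>. {x \<in> topspace X. f x \<in> K})" by auto
    with * show "openin X {x \<in> topspace X. f x \<in> \<Union>\<K>}" and "\<Union>\<K> \<subseteq> f ` topspace X" by auto
  qed
  then show ?thesis by (simp add: quotient_topology_def)
qed

lemma topspace_quotient_topology: "topspace (quotient_topology X f) = f ` topspace X"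
proof
  show "topspace (quotient_topology X f) \<subseteq> f ` topspace X"
    using openin_quotient_topology[of X f "topspace (quotient_topology X f)"] by simp
  have "openin (quotient_topology X f) (f ` topspace X)"
    by (auto simp: openin_quotient_topology intro: openin_subopen[THEN iffD2])
  then show "f ` topspace X \<subseteq> topspace (quotient_topology X f)"
    by (rule openin_subset)
qed

lemma quotient_map_quotient_topology: "quotient_map X (quotient_topology X f) f"
  by (auto simp: quotient_map_def topspace_quotient_topology openin_quotient_topology)


section \<open>Flags and the limit set\<close>

type_synonym flag = "(real^3) set \<times> (real^3) set"

definition flags :: "flag set" where
  "flags = {(V1, V2). subspace V1 \<and> subspace V2 \<and> dim V1 = 1 \<and> dim V2 = 2 \<and> V1 \<subseteq> V2}"

definition std_flag :: flag where
  "std_flag = (span {axis 1 1}, span {axis 1 1, axis 2 1})"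

definition flag_act :: "real^3^3 \<Rightarrow> flag \<Rightarrow> flag" where
  "flag_act A F = ((\<lambda>v. A *v v) ` fst F, (\<lambda>v. A *v v) ` snd F)"

text \<open>
  The flag manifold as the homogeneous space \<open>GL\<^sub>3(\<real>)/P\<close>, with \<open>P\<close> the stabiliser of the standard flag.
\<close>
definition flag_space :: "flag topology" where
  "flag_space = quotient_topology (top_of_set {A. invertible A}) (\<lambda>A. flag_act A std_flag)"

lemma topspace_flag_space: "topspace flag_space = flags"
proof
  show "topspace flag_space \<subseteq> flags"
  proof
    fix F assume "F \<in> topspace flag_space"
    then obtain A :: "real^3^3" where A: "invertible A" "F = flag_act A std_flag"
      by (auto simp: flag_space_def topspace_quotient_topology)
    have inj: "inj ((*v) A)" using A(1) by (simp add: inj_matrix_vector_mult)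
    have dimA: "dim ((*v) A ` V) = dim V" for V
      using inj by (intro dim_image_eq) (auto intro: inj_on_subset)
    have d1: "dim (span {axis 1 1 :: real^3}) = 1"
      by (simp add: dim_eq_card_independent axis_eq_0_iff)
    have "independent {axis 1 1, axis 2 1 :: real^3}"
      by (rule independent_mono[OF independent_Basis]) (auto simp: Basis_vec_def)
    then have d2: "dim (span {axis 1 1, axis 2 1 :: real^3}) = 2"
      by (subst dim_span, subst dim_eq_card_independent) (auto simp: axis_eq_axis)
    have sub: "span {axis 1 1 :: real^3} \<subseteq> span {axis 1 1, axis 2 1}"
      by (rule span_mono) auto
    have sp: "subspace ((*v) A ` span S)" for S
      by (intro linear_subspace_image matrix_vector_mul_linear subspace_span)
    show "F \<in> flags"
      unfolding A(2) flags_def flag_act_def std_flag_def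
      using d1 d2 sp image_mono[OF sub] by (simp only: mem_Collect_eq case_prod_conv fst_conv snd_conv dimA) simp
  qed
next
  show "flags \<subseteq> topspace flag_space"
  proof
    fix F assume "F \<in> flags"
    then obtain V1 V2 where F: "F = (V1, V2)" "subspace V1" "subspace V2"
      "dim V1 = 1" "dim V2 = 2" "V1 \<subseteq> V2" by (auto simp: flags_def)
    obtain B1 where B1: "B1 \<subseteq> V1" "independent B1" "V1 \<subseteq> span B1" "card B1 = 1"
      using basis_exists[of V1] F(4) by metis
    obtain B2 where B2: "B1 \<subseteq> B2" "B2 \<subseteq> V2" "independent B2" "V2 \<subseteq> span B2"
      using maximal_independent_subset_extend[of B1 V2] B1 F(6) by (metis subset_trans)
    obtain B3 where B3: "B2 \<subseteq> B3" "independent B3" "UNIV \<subseteq> span B3"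
      using maximal_independent_subset_extend[of B2 UNIV] B2(3) by (metis subset_UNIV)
    have c2: "card B2 = 2" using F(5) B2 by (metis basis_card_eq_dim)
    have c3: "card B3 = 3"
      using B3 basis_card_eq_dim[of B3 UNIV] by simp
    obtain a where a: "B1 = {a}" using B1(4) by (metis card_1_singletonE)
    obtain b where b: "B2 = {a, b}" "a \<noteq> b"
      using c2 B2(1) a by (auto simp: card_2_iff)
    obtain c where c: "B3 = {a, b, c}"
    proof -
      have "finite B3" using c3 by (metis card.infinite zero_neq_numeral)
      then have "card (B3 - B2) = 1"
        using c2 c3 B3(1) by (subst card_Diff_subset) (auto intro: finite_subset)
      then obtain c where "B3 - B2 = {c}" by (metis card_1_singletonE)
      then show ?thesis using that[of c] b B3(1) by blast
    qed
    define A :: "real^3^3" where "A = transpose (vector [a, b, c])"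
    have cols: "A *v axis 1 1 = a" "A *v axis 2 1 = b" "A *v axis 3 1 = c"
      by (simp_all add: A_def matrix_vector_mult_basis column_transpose row_def vec_nth_inverse)
    have lin: "linear ((*v) A)" by simp
    have s1: "(*v) A ` span {axis 1 1} = span B1"
      using span_linear_image[OF lin, of "{axis 1 1}"] cols a by simp
    have s2: "(*v) A ` span {axis 1 1, axis 2 1} = span B2"
      using span_linear_image[OF lin, of "{axis 1 1, axis 2 1}"] cols b by simp
    have "(*v) A ` span {axis 1 1, axis 2 1, axis 3 1} = span B3"
      using span_linear_image[OF lin, of "{axis 1 1, axis 2 1, axis 3 1}"] cols c by simp
    then have "surj ((*v) A)" using B3(3) by blast
    then have "invertible A"
      by (metis matrix_right_invertible_surjective invertible_right_inverse)
    moreover have "span B1 = V1" "span B2 = V2"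
      using B1 B2 F by (meson span_minimal subset_antisym)+
    ultimately have "F = flag_act A std_flag" and "invertible A"
      using F(1) s1 s2 by (simp_all add: flag_act_def std_flag_def)
    then show "F \<in> topspace flag_space"
      by (auto simp: flag_space_def topspace_quotient_topology)
  qed
qed

definition limit_set :: "(real^3^3) set \<Rightarrow> flag set" where
  "limit_set \<Gamma> = {F. \<exists>(\<gamma> :: nat \<Rightarrow> real^3^3) k k'.
     range \<gamma> \<subseteq> \<Gamma> \<and> inj \<gamma> \<and>
     (\<forall>j. orthogonal_matrix (k j) \<and> orthogonal_matrix (k' j) \<and>
          \<gamma> j = k j ** singular_diag (\<gamma> j) ** k' j) \<and>
     limitin flag_space (\<lambda>j. flag_act (k j) std_flag) F sequentially}"

definition transverse :: "flag \<Rightarrow> flag \<Rightarrow> bool" where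
  "transverse F F' \<longleftrightarrow> \<not> fst F \<subseteq> snd F' \<and> \<not> fst F' \<subseteq> snd F"

definition antipodal :: "(real^3^3) set \<Rightarrow> bool" where
  "antipodal \<Gamma> \<longleftrightarrow> (\<forall>F\<in>limit_set \<Gamma>. \<forall>F'\<in>limit_set \<Gamma>. F \<noteq> F' \<longrightarrow> transverse F F')"

definition topological_circle :: "'a topology \<Rightarrow> bool" where
  "topological_circle X \<longleftrightarrow> X homeomorphic_space top_of_set (sphere (0 :: real^2) 1)"


section \<open>Reducible copies of \<open>SL\<^sub>2(\<real>)\<close> and Zariski density\<close>

definition block_embed :: "real^2^2 \<Rightarrow> real^3^3" where
  "block_embed g =
     vector [vector [g $ 1 $ 1, g $ 1 $ 2, 0],
             vector [g $ 2 $ 1, g $ 2 $ 2, 0],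
             vector [0, 0, 1]]"

definition reducible_SL2 :: "(real^3^3) set \<Rightarrow> bool" where
  "reducible_SL2 H \<longleftrightarrow>
     (\<exists>h\<in>carrier SL3. H = {h ** block_embed g ** matrix_inv h | g. det g = 1})"

text \<open>
  The closure is taken in the affine space of all matrices, in which \<open>SL\<^sub>3(\<real>)\<close> is Zariski closed.
\<close>
definition zariski_closure :: "(real^'n^'m) set \<Rightarrow> (real^'n^'m) set" where
  "zariski_closure S =
     {A. \<forall>p. real_polynomial_function p \<and> (\<forall>B\<in>S. p B = 0) \<longrightarrow> p A = 0}"


section \<open>The projective plane\<close>

definition RP2 :: "(real^3) set topology" where
  "RP2 = quotient_topology (top_of_set (UNIV - {0})) (\<lambda>v. span {v})"

lemma topspace_RP2: "topspace RP2 = {L. subspace L \<and> dim L = 1}"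
proof -
  have "\<exists>v. v \<noteq> 0 \<and> L = span {v}" if L: "subspace L" "dim L = 1" for L :: "(real^3) set"
  proof -
    obtain B where B: "B \<subseteq> L" "independent B" "L \<subseteq> span B" "card B = dim L"
      using basis_exists by blast
    with L obtain v where v: "B = {v}" by (metis card_1_singletonE)
    have "L = span {v}" using B v L span_minimal[of B L] by blast
    moreover have "v \<noteq> 0" using B v dependent_single by blast
    ultimately show ?thesis by blast
  qed
  moreover have "dim (span {v}) = 1" if "v \<noteq> 0" for v :: "real^3"
    using that by (simp add: dim_eq_card_independent)
  ultimately show ?thesis
    by (auto simp: RP2_def topspace_quotient_topology image_iff)
qed

definition orbit_RP2 :: "(real^3^3) set \<Rightarrow> (real^3) set \<Rightarrow> (real^3) set set" where
  "orbit_RP2 \<Gamma> L = (\<lambda>\<gamma>. (\<lambda>v. \<gamma> *v v) ` L) ` \<Gamma>"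

end

theory Submission
  imports Defs
begin

text \<open>
  Write \<open>\<Lambda>\<close> for the limit set. The group \<open>H\<close> fixes a line pointwise and preserves a unique plane complementary
  to it. A dense orbit exists, by Baire's theorem, as soon as every nonempty
  \<open>\<Gamma>\<close>-invariant open cone \<open>W\<close> in \<open>\<real>\<^sup>3\<close> is dense. Two facts give this density.

  \<^item> The planes of the flags in \<open>\<Lambda>\<close> cover \<open>\<real>\<^sup>3\<close> (\<open>limit_planes_cover\<close>). Suppose that \<open>p\<close> lies on none
    of them. For a vector \<open>v\<close> and a flag whose plane has normal \<open>n\<close>, the sign of \<open>(n \<bullet> p) (n \<bullet> v)\<close> does
    not depend on the choice of \<open>n\<close>. If \<open>v\<close> spans the line of a flag \<open>X \<in> \<Lambda>\<close>, then by antipodality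
    this quantity vanishes on \<open>\<Lambda>\<close> only at \<open>X\<close>, and since a circle minus a point is connected, it
    has constant sign on the rest of \<open>\<Lambda>\<close>. Zariski density of \<open>\<Gamma> \<inter> H\<close> provides three such vectors, with
    distinct lines in the plane preserved by \<open>H\<close>. Evaluating the linear relation between them
    at the three flags yields incompatible signs. This is an elementary form of the statement that the
    loop of planes is not null-homotopic in the dual projective plane.

  \<^item> Let \<open>\<gamma>\<^sub>j = k\<^sub>j a\<^sub>j k'\<^sub>j\<close> be a divergent sequence in \<open>\<Gamma>\<close> with \<open>k\<^sub>j\<close> and \<open>k'\<^sub>j\<close> convergent; it has an
    attracting and a repelling flag in \<open>\<Lambda>\<close>. Because both singular value gaps tend to infinity, the
    sets \<open>\<gamma>\<^sub>j\<^sup>-\<^sup>1 W\<close> accumulate on the whole repelling plane as soon as the open cone \<open>W\<close> meets the attracting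
    plane, and the images under \<open>\<gamma>\<^sub>j\<close> of any plane that misses the repelling line converge to the
    attracting plane.

  By the cover, \<open>W\<close> meets the plane of some flag in \<open>\<Lambda>\<close>, so the closure of \<open>W\<close> contains the plane of
  some \<open>Y \<in> \<Lambda>\<close>. Some translate of this plane by \<open>\<Gamma> \<inter> H\<close> misses a given repelling line, again by
  Zariski density together with antipodality (\<open>limit_line_moves_off_limit_plane\<close>). Hence the closure of
  \<open>W\<close> contains the planes of all flags in \<open>\<Lambda>\<close>, and these cover \<open>\<real>\<^sup>3\<close>.
\<close>

section \<open>Singular value decomposition\<close>

definition diag3 :: "real \<Rightarrow> real \<Rightarrow> real \<Rightarrow> real^3^3" where
  "diag3 a b c = vector [vector [a, 0, 0], vector [0, b, 0], vector [0, 0, c]]"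

lemma diag3_nth: "(diag3 a b c *v x) $ 1 = a * x $ 1" "(diag3 a b c *v x) $ 2 = b * x $ 2"
    "(diag3 a b c *v x) $ 3 = c * x $ 3"
  by (simp_all add: diag3_def matrix_vector_mult_def sum_3)

lemma vec3_eq_iff: "x = y \<longleftrightarrow> x $ 1 = y $ 1 \<and> x $ 2 = y $ 2 \<and> x $ 3 = y $ 3" for x y :: "'a^3"
  by (simp add: vec_eq_iff forall_3)

text \<open>
  One step of the singular value decomposition. If \<open>v\<close> maximises \<open>norm (A *v v)\<close> on the unit sphere
  of \<open>S\<close>, then the first-order condition at \<open>v\<close> says that \<open>A\<close> maps the part of \<open>S\<close> orthogonal to \<open>v\<close>
  into the orthogonal complement of \<open>A *v v\<close>.
\<close>
lemma maximal_stretch_direction: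
  fixes A :: "real^'n^'m" and S :: "(real^'n) set"
  assumes S: "subspace S" and ex: "\<exists>x\<in>S. x \<noteq> 0"
  obtains v where "v \<in> S" "norm v = 1" "\<And>w. w \<in> S \<Longrightarrow> norm (A *v w) \<le> norm (A *v v) * norm w"
    "\<And>w. w \<in> S \<Longrightarrow> w \<bullet> v = 0 \<Longrightarrow> (A *v w) \<bullet> (A *v v) = 0"
proof -
  have "compact (sphere 0 1 \<inter> S)"
    by (intro compact_Int_closed closed_subspace S) auto
  moreover obtain x where "x \<in> S" "x \<noteq> 0" using ex by blast
  then have "x /\<^sub>R norm x \<in> sphere 0 1 \<inter> S" using S by (simp add: subspace_scale)
  then have "sphere 0 1 \<inter> S \<noteq> {}" by blast
  moreover have "continuous_on (sphere 0 1 \<inter> S) (\<lambda>x. norm (A *v x))"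
    by (intro continuous_intros)
  ultimately obtain v where v: "v \<in> sphere 0 1 \<inter> S"
    and max: "\<And>w. w \<in> sphere 0 1 \<inter> S \<Longrightarrow> norm (A *v w) \<le> norm (A *v v)"
    using continuous_attains_sup by metis
  have nv: "norm v = 1" "v \<in> S" using v by auto
  have bound: "norm (A *v w) \<le> norm (A *v v) * norm w" if "w \<in> S" for w
  proof (cases "w = 0")
    case False
    have "norm (A *v (w /\<^sub>R norm w)) \<le> norm (A *v v)"
      using max[of "w /\<^sub>R norm w"] False that S by (simp add: subspace_scale)
    with False show ?thesis by (simp add: matrix_vector_mult_scaleR field_simps)
  qed simp
  have orth: "(A *v w) \<bullet> (A *v v) = 0" if w: "w \<in> S" "w \<bullet> v = 0" for w
  proof -
    define p where "p = (A *v w) \<bullet> (A *v v)"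
    define q where "q = (norm (A *v v))\<^sup>2 * (norm w)\<^sup>2 - (norm (A *v w))\<^sup>2"
    have *: "2 * t * p \<le> t\<^sup>2 * q" for t
    proof -
      have "(norm (A *v (v + t *\<^sub>R w)))\<^sup>2 \<le> (norm (A *v v) * norm (v + t *\<^sub>R w))\<^sup>2"
        using bound[of "v + t *\<^sub>R w"] nv w S by (intro power_mono) (auto intro: subspace_add subspace_scale)
      moreover have "(norm (v + t *\<^sub>R w))\<^sup>2 = 1 + t\<^sup>2 * (norm w)\<^sup>2"
        using w nv(1) unfolding power2_norm_eq_inner norm_eq_1
        by (simp add: inner_add_left inner_add_right inner_commute power2_eq_square)
      moreover have "(norm (A *v (v + t *\<^sub>R w)))\<^sup>2 = (norm (A *v v))\<^sup>2 + 2 * t * p + t\<^sup>2 * (norm (A *v w))\<^sup>2"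
        unfolding power2_norm_eq_inner p_def
        by (simp add: matrix_vector_right_distrib matrix_vector_mult_scaleR inner_add_left inner_add_right
            inner_commute power2_eq_square)
      ultimately show ?thesis by (simp add: q_def power_mult_distrib algebra_simps)
    qed
    \<comment> \<open>A linear term dominated by a quadratic one for all \<open>t\<close>: test it at \<open>t = p / (\<bar>q\<bar> + 1)\<close>.\<close>
    have "p = 0"
    proof (rule ccontr)
      assume "p \<noteq> 0"
      have q: "0 < \<bar>q\<bar> + 1" by linarith
      have "2 * (p / (\<bar>q\<bar> + 1)) * p \<le> (p / (\<bar>q\<bar> + 1))\<^sup>2 * q" by (rule *)
      also have "\<dots> \<le> (p / (\<bar>q\<bar> + 1))\<^sup>2 * (\<bar>q\<bar> + 1)" by (intro mult_left_mono) auto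
      also have "\<dots> = (p / (\<bar>q\<bar> + 1)) * p" using q by (simp add: power2_eq_square)
      finally have "2 * (p * p / (\<bar>q\<bar> + 1)) \<le> p * p / (\<bar>q\<bar> + 1)" by simp
      moreover have "0 < p * p / (\<bar>q\<bar> + 1)"
        using \<open>p \<noteq> 0\<close> q not_real_square_gt_zero[of p] by (intro divide_pos_pos) blast+
      ultimately show False by linarith
    qed
    then show ?thesis by (simp add: p_def)
  qed
  show ?thesis using that nv bound orth by blast
qed

lemma orthogonal_matrix_rows3:
  fixes u v w :: "real^3"
  assumes "norm u = 1" "norm v = 1" "norm w = 1" "u \<bullet> v = 0" "u \<bullet> w = 0" "v \<bullet> w = 0"
  shows "orthogonal_matrix (vector [u, v, w] :: real^3^3)"
  unfolding orthogonal_matrix_orthonormal_rows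
  using assms by (auto simp: row_def orthogonal_def forall_3 vec_nth_inverse inner_commute)

text \<open>
  Maximal stretch directions are split off successively from \<open>\<real>\<^sup>3\<close> and from the orthogonal complement of the
  first one; the third direction is then determined up to sign, and the cross product picks it.
\<close>
lemma singular_value_decomposition:
  fixes A :: "real^3^3"
  assumes A: "det A \<noteq> 0"
  obtains k k' a b c where "orthogonal_matrix k" "orthogonal_matrix k'" "a \<ge> b" "b \<ge> c" "c > 0"
    "A = k ** diag3 a b c ** k'"
proof -
  have inj: "A *v x \<noteq> 0" if "x \<noteq> 0" for x
    using A that by (metis invertible_det_nz invertible_def matrix_left_invertible_ker)
  obtain v1 where v1: "norm v1 = 1" "\<And>w. norm (A *v w) \<le> norm (A *v v1) * norm w"
    "\<And>w. w \<bullet> v1 = 0 \<Longrightarrow> (A *v w) \<bullet> (A *v v1) = 0"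
  proof (rule maximal_stretch_direction[of UNIV A])
    show "\<exists>x\<in>UNIV. x \<noteq> (0::real^3)" using one_neq_zero by blast
  qed auto
  define S1 where "S1 = {x. x \<bullet> v1 = 0}"
  have s1: "subspace S1" by (auto simp: S1_def subspace_def inner_add_left)
  have ex1: "\<exists>x\<in>S1. x \<noteq> 0"
    using orthogonal_to_vector_exists[of v1] by (auto simp: S1_def orthogonal_def inner_commute)
  obtain v2 where v2: "v2 \<in> S1" "norm v2 = 1" "\<And>w. w \<in> S1 \<Longrightarrow> norm (A *v w) \<le> norm (A *v v2) * norm w"
    "\<And>w. w \<in> S1 \<Longrightarrow> w \<bullet> v2 = 0 \<Longrightarrow> (A *v w) \<bullet> (A *v v2) = 0"
    using maximal_stretch_direction[OF s1 ex1] by metis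
  have 12: "v2 \<bullet> v1 = 0" using v2(1) by (simp add: S1_def)
  define v3 where "v3 = cross3 v1 v2"
  have 3: "v3 \<bullet> v1 = 0" "v3 \<bullet> v2 = 0"
    by (simp_all add: v3_def dot_cross_self)
  have "(norm v3)\<^sup>2 = 1" using norm_cross_dot[of v1 v2] v1(1) v2(2) 12
    by (simp add: v3_def inner_commute)
  then have n3: "norm v3 = 1" by (simp add: power2_eq_1_iff) (smt (verit) norm_ge_zero)
  have v3S: "v3 \<in> S1" using 3 by (simp add: S1_def)
  define a b c where "a = norm (A *v v1)" and "b = norm (A *v v2)" and "c = norm (A *v v3)"
  have pos: "a > 0" "b > 0" "c > 0"
    using inj[of v1] inj[of v2] inj[of v3] v1(1) v2(2) n3 unfolding a_def b_def c_def
    by (metis norm_zero zero_less_norm_iff zero_neq_one)+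
  have ge: "a \<ge> b" "b \<ge> c" using v1(2)[of v2] v2(2) v2(3)[OF v3S] n3 by (simp_all add: a_def b_def c_def)
  define k' :: "real^3^3" where "k' = vector [v1, v2, v3]"
  define l :: "real^3^3" where "l = vector [(A *v v1) /\<^sub>R a, (A *v v2) /\<^sub>R b, (A *v v3) /\<^sub>R c]"
  have k': "orthogonal_matrix k'" unfolding k'_def
    using v1(1) v2(2) n3 12 3 by (intro orthogonal_matrix_rows3) (auto simp: inner_commute)
  have l: "orthogonal_matrix l" unfolding l_def
    using pos v1(3)[OF 12] v1(3)[OF 3(1)] v2(4)[OF v3S 3(2)]
    by (intro orthogonal_matrix_rows3) (auto simp: a_def b_def c_def inner_commute)
  have "A ** transpose k' = transpose l ** diag3 a b c"
    using pos
    by (simp add: vec3_eq_iff k'_def l_def diag3_def matrix_matrix_mult_def transpose_def sum_3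
        matrix_vector_mult_def)
  then have "A ** (transpose k' ** k') = transpose l ** diag3 a b c ** k'"
    by (simp add: matrix_mul_assoc)
  then have "A = transpose l ** diag3 a b c ** k'"
    using k' by (simp add: orthogonal_matrix)
  then show ?thesis using that[of "transpose l" k' b a c] l k' pos ge by simp
qed

lemma SL3_singular_diag:
  assumes "det A = 1"
  obtains k k' where "orthogonal_matrix k" "orthogonal_matrix k'" "A = k ** singular_diag A ** k'"
proof -
  obtain k k' a b c where *: "orthogonal_matrix k" "orthogonal_matrix k'" "a \<ge> b" "b \<ge> c" "c > 0"
    "A = k ** diag3 a b c ** k'" using singular_value_decomposition[of A] assms by (metis one_neq_zero)
  then have "singular_values A = [a, b, c]"
    by (intro singular_values_eqI[of k k']) (auto simp: diag3_def)
  then have "singular_diag A = diag3 a b c" by (simp add: singular_diag_def diag3_def singular_value_def)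
  with * that show ?thesis by metis
qed

section \<open>Orthogonal matrices and flags\<close>

text \<open>
  Transposed orthogonal matrices are inverses below, and the cancellation rules for them need
  \<open>transpose k *v x\<close> to stay in this form.
\<close>
declare transpose_matrix_vector [simp del]

lemma tendsto_matrix_vector_mult [tendsto_intros]:
  fixes A :: "'b \<Rightarrow> real^'n^'m"
  assumes "(A \<longlongrightarrow> B) F" "(x \<longlongrightarrow> y) F"
  shows "((\<lambda>j. A j *v x j) \<longlongrightarrow> B *v y) F"
  unfolding matrix_vector_mult_def by (intro tendsto_intros assms)

lemma tendsto_matrix_mult [tendsto_intros]:
  fixes A :: "'b \<Rightarrow> real^'n^'m" and C :: "'b \<Rightarrow> real^'k^'n"
  assumes "(A \<longlongrightarrow> B) F" "(C \<longlongrightarrow> D) F"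
  shows "((\<lambda>j. A j ** C j) \<longlongrightarrow> B ** D) F"
  unfolding matrix_matrix_mult_def by (intro tendsto_intros assms)

lemma tendsto_transpose [tendsto_intros]:
  fixes A :: "'b \<Rightarrow> real^'n^'m"
  assumes "(A \<longlongrightarrow> B) F"
  shows "((\<lambda>j. transpose (A j)) \<longlongrightarrow> transpose B) F"
  unfolding transpose_def by (intro tendsto_intros assms)

lemma tendsto_vector3 [tendsto_intros]:
  fixes p q r :: "'b \<Rightarrow> real"
  assumes "(p \<longlongrightarrow> p') F" "(q \<longlongrightarrow> q') F" "(r \<longlongrightarrow> r') F"
  shows "((\<lambda>j. vector [p j, q j, r j] :: real^3) \<longlongrightarrow> vector [p', q', r']) F"
proof (rule vec_tendstoI)
  fix i :: 3
  show "((\<lambda>j. vector [p j, q j, r j] $ i) \<longlongrightarrow> vector [p', q', r'] $ i) F"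
    using exhaust_3[of i] assms by auto
qed

lemma compact_orthogonal_matrices: "compact {k :: real^'n^'n. orthogonal_matrix k}"
proof -
  have "norm k \<le> CARD('n)" if "orthogonal_matrix k" for k :: "real^'n^'n"
  proof -
    have "norm (k $ i) = 1" for i
      using that by (simp add: orthogonal_matrix_orthonormal_rows row_def vec_nth_inverse)
    then show ?thesis
      using L2_set_le_sum[of UNIV "\<lambda>i. norm (k $ i)"] by (simp add: norm_vec_def)
  qed
  moreover have "closed {k :: real^'n^'n. orthogonal_matrix k}"
    unfolding closed_sequential_limits
  proof safe
    fix k :: "nat \<Rightarrow> real^'n^'n" and l
    assume k: "\<forall>n. k n \<in> {k. orthogonal_matrix k}" and l: "k \<longlonglongrightarrow> l"
    have "(\<lambda>n. transpose (k n) ** k n) \<longlonglongrightarrow> transpose l ** l"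
      by (intro tendsto_intros l)
    moreover have "(\<lambda>n. transpose (k n) ** k n) = (\<lambda>n. mat 1)"
      using k by (simp add: orthogonal_matrix)
    ultimately show "orthogonal_matrix l"
      using LIMSEQ_const_iff orthogonal_matrix by metis
  qed
  ultimately show ?thesis
    unfolding compact_eq_bounded_closed bounded_iff by blast
qed

text \<open>
  The longest Weyl group element: conjugation by it reverses the order of the singular values, as
  is needed to bring the inverse of a matrix into the standard form.
\<close>
definition reversal3 :: "real^3^3" where
  "reversal3 = vector [vector [0, 0, 1], vector [0, 1, 0], vector [1, 0, 0]]"

lemma orthogonal_reversal3: "orthogonal_matrix reversal3"
  by (simp add: orthogonal_matrix_def reversal3_def vec3_eq_iff matrix_matrix_mult_def transpose_def sum_3 mat_def)

lemma reversal3_diag3: "reversal3 ** diag3 a b c ** reversal3 = diag3 c b a"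
  by (simp add: reversal3_def diag3_def vec3_eq_iff matrix_matrix_mult_def sum_3)

lemma reversal3_nth: "(reversal3 *v x) $ 1 = x $ 3" "(reversal3 *v x) $ 2 = x $ 2" "(reversal3 *v x) $ 3 = x $ 1"
  by (simp_all add: reversal3_def matrix_vector_mult_def sum_3)

lemma orthogonal_cancel [simp]:
  fixes k :: "real^'n^'n"
  assumes "orthogonal_matrix k"
  shows "transpose k *v (k *v x) = x" "k *v (transpose k *v x) = x"
  using assms unfolding orthogonal_matrix_def by (simp_all add: matrix_vector_mul_assoc)

lemma inner_transpose_cancel:
  fixes k :: "real^'n^'n"
  assumes "orthogonal_matrix k"
  shows "(transpose k *v x) \<bullet> (transpose k *v y) = x \<bullet> y"
  using assms by (simp add: transpose_matrix_vector dot_lmul_matrix)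
    (simp add: transpose_matrix_vector[symmetric])

lemma span_axis_3:
  "span {axis 1 1 :: real^3} = {x. x $ 2 = 0 \<and> x $ 3 = 0}"
  "span {axis 1 1, axis 2 1 :: real^3} = {x. x $ 3 = 0}"
proof -
  have "x \<in> span {axis 1 1 :: real^3} \<longleftrightarrow> x $ 2 = 0 \<and> x $ 3 = 0" for x
    by (auto simp: span_singleton vec3_eq_iff axis_def)
  then show "span {axis 1 1 :: real^3} = {x. x $ 2 = 0 \<and> x $ 3 = 0}" by auto
  have "x \<in> span {axis 1 1, axis 2 1 :: real^3} \<longleftrightarrow> x $ 3 = 0" for x
  proof
    assume "x $ 3 = 0"
    then have "x = x $ 1 *\<^sub>R axis 1 1 + x $ 2 *\<^sub>R axis 2 1" by (simp add: vec3_eq_iff axis_def)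
    then show "x \<in> span {axis 1 1, axis 2 1}"
      by (metis span_add span_base span_scale insertCI)
  next
    assume "x \<in> span {axis 1 1, axis 2 1}"
    then show "x $ 3 = 0" by (induction rule: span_induct_alt) (auto simp: axis_def)
  qed
  then show "span {axis 1 1, axis 2 1 :: real^3} = {x. x $ 3 = 0}" by auto
qed

lemma flag_act_orthogonal:
  fixes k :: "real^3^3"
  assumes "orthogonal_matrix k"
  shows "fst (flag_act k std_flag) = {x. (transpose k *v x) $ 2 = 0 \<and> (transpose k *v x) $ 3 = 0}"
    and "snd (flag_act k std_flag) = {x. (transpose k *v x) $ 3 = 0}"
proof -
  have "(*v) k ` {x. P x} = {x. P (transpose k *v x)}" for P
    using assms by (force simp: image_iff intro: exI[of _ "transpose k *v _"])
  then show "fst (flag_act k std_flag) = {x. (transpose k *v x) $ 2 = 0 \<and> (transpose k *v x) $ 3 = 0}"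
    and "snd (flag_act k std_flag) = {x. (transpose k *v x) $ 3 = 0}"
    by (simp_all add: flag_act_def std_flag_def span_axis_3)
qed

lemma limitin_flag_act:
  assumes "\<And>j. invertible (A j)" "A \<longlonglongrightarrow> B" "invertible B"
  shows "limitin flag_space (\<lambda>j. flag_act (A j) std_flag) (flag_act B std_flag) sequentially"
proof -
  have "continuous_map (top_of_set {A. invertible A}) flag_space (\<lambda>A. flag_act A std_flag)"
    unfolding flag_space_def by (intro quotient_imp_continuous_map quotient_map_quotient_topology)
  moreover have "limitin (top_of_set {A. invertible A}) A B sequentially"
    using assms by (simp add: limitin_subtopology)
  ultimately show ?thesis
    using continuous_map_limit by (force simp: o_def)
qed

lemma orthogonal_imp_invertible: "orthogonal_matrix k \<Longrightarrow> invertible k"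
  unfolding orthogonal_matrix_def invertible_def by blast

section \<open>Sequences with convergent Cartan decomposition\<close>

lemma cube_tendsto_zero:
  fixes x :: "nat \<Rightarrow> real"
  assumes "(\<lambda>j. x j ^ 3) \<longlonglongrightarrow> 0"
  shows "x \<longlonglongrightarrow> 0"
proof -
  have "(\<lambda>j. root 3 (x j ^ 3)) \<longlonglongrightarrow> root 3 0" by (intro tendsto_intros assms)
  then show ?thesis by (simp add: odd_real_root_power_cancel)
qed

text \<open>
  A sequence of matrices whose singular value gaps tend to infinity and whose orthogonal
  factors converge. Regularity of a group and compactness of the orthogonal group give such a
  subsequence of every injective sequence in the group.
\<close>
locale cartan_limit =
  fixes g k k' :: "nat \<Rightarrow> real^3^3" and a b c :: "nat \<Rightarrow> real" and l l' :: "real^3^3"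
  assumes decomposition: "g j = k j ** diag3 (a j) (b j) (c j) ** k' j"
    and orth: "orthogonal_matrix (k j)" "orthogonal_matrix (k' j)"
    and positive: "a j > 0" "b j > 0" "c j > 0"
    and ratios: "(\<lambda>j. b j / a j) \<longlonglongrightarrow> 0" "(\<lambda>j. c j / b j) \<longlonglongrightarrow> 0"
    and limits: "k \<longlonglongrightarrow> l" "k' \<longlonglongrightarrow> l'"
    and orth_limits: "orthogonal_matrix l" "orthogonal_matrix l'"
begin

definition attracting :: flag where "attracting = flag_act l std_flag"
definition repelling :: flag where "repelling = flag_act (transpose l' ** reversal3) std_flag"

lemma attracting_iff:
  "fst attracting = {x. (transpose l *v x) $ 2 = 0 \<and> (transpose l *v x) $ 3 = 0}"
  "snd attracting = {x. (transpose l *v x) $ 3 = 0}"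
  unfolding attracting_def by (rule flag_act_orthogonal[OF orth_limits(1)])+

lemma repelling_iff:
  "fst repelling = {x. (l' *v x) $ 1 = 0 \<and> (l' *v x) $ 2 = 0}"
  "snd repelling = {x. (l' *v x) $ 1 = 0}"
proof -
  have "orthogonal_matrix (transpose l' ** reversal3)"
    by (intro orthogonal_matrix_mul orthogonal_reversal3) (simp add: orth_limits)
  moreover have "transpose reversal3 = reversal3"
    by (simp add: reversal3_def transpose_def vec3_eq_iff)
  then have "transpose (transpose l' ** reversal3) *v x = reversal3 *v (l' *v x)" for x
    by (simp add: matrix_transpose_mul matrix_vector_mul_assoc)
  ultimately show "fst repelling = {x. (l' *v x) $ 1 = 0 \<and> (l' *v x) $ 2 = 0}"
    and "snd repelling = {x. (l' *v x) $ 1 = 0}"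
    by (auto simp: repelling_def flag_act_orthogonal reversal3_nth)
qed

lemma action: "g j *v x = k j *v (diag3 (a j) (b j) (c j) *v (k' j *v x))"
  by (simp add: decomposition matrix_vector_mul_assoc[symmetric])

lemma ratio_outer: "(\<lambda>j. c j / a j) \<longlonglongrightarrow> 0"
proof -
  have "(\<lambda>j. (c j / b j) * (b j / a j)) \<longlonglongrightarrow> 0 * 0" by (intro tendsto_mult ratios)
  moreover have "(\<lambda>j. (c j / b j) * (b j / a j)) = (\<lambda>j. c j / a j)"
  proof
    fix j
    show "(c j / b j) * (b j / a j) = c j / a j" using positive[of j] by simp
  qed
  ultimately show ?thesis by simp
qed

text \<open>
  Divided by the largest singular value, the sequence converges to an operator of rank one with
  the attracting line as its image.
\<close>
lemma tendsto_rescaled_attracting: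
  "(\<lambda>j. (1 / a j) *\<^sub>R (g j *v x)) \<longlonglongrightarrow> (l' *v x) $ 1 *\<^sub>R (l *v axis 1 1)"
proof -
  define y where "y j = k' j *v x" for j
  have y: "y \<longlonglongrightarrow> l' *v x" unfolding y_def by (intro tendsto_intros limits)
  have "(\<lambda>j. k j *v vector [y j $ 1, b j / a j * y j $ 2, c j / a j * y j $ 3])
      \<longlonglongrightarrow> l *v vector [(l' *v x) $ 1, 0 * (l' *v x) $ 2, 0 * (l' *v x) $ 3]"
    by (intro tendsto_intros limits y ratios ratio_outer)
  moreover have "k j *v vector [y j $ 1, b j / a j * y j $ 2, c j / a j * y j $ 3] = (1 / a j) *\<^sub>R (g j *v x)" for j
  proof -
    have "vector [y j $ 1, b j / a j * y j $ 2, c j / a j * y j $ 3] =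
        (1 / a j) *\<^sub>R (diag3 (a j) (b j) (c j) *v y j)"
      using positive[of j] by (simp add: vec3_eq_iff diag3_nth)
    then show ?thesis by (simp add: action y_def matrix_vector_mult_scaleR)
  qed
  moreover have "vector [(l' *v x) $ 1, 0 * (l' *v x) $ 2, 0 * (l' *v x) $ 3] = (l' *v x) $ 1 *\<^sub>R (axis 1 1 :: real^3)"
    by (auto simp: vec3_eq_iff axis_def)
  ultimately show ?thesis by (simp add: matrix_vector_mult_scaleR)
qed

text \<open>
  However a convergent rescaling of the sequence is chosen, the limit is a multiple of the rank-one
  operator above. This identifies attracting lines without computing singular values.
\<close>
lemma range_limit_subset_attracting_line:
  assumes "\<And>x. (\<lambda>j. s j *\<^sub>R (g j *v x)) \<longlonglongrightarrow> M x"
  shows "M x \<in> fst attracting"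
proof -
  define u where "u = l *v axis 1 1"
  define x0 where "x0 = transpose l' *v axis 1 1"
  have u: "u \<bullet> u = 1"
    using inner_transpose_cancel[OF orth_limits(1), of u u] orth_limits(1)
    by (simp add: u_def inner_axis_axis)
  \<comment> \<open>On \<open>x0\<close> the rank-one limit takes the unit value \<open>u\<close>, so the component along \<open>u\<close> compares the two rescalings.\<close>
  define r where "r = (M x0) \<bullet> u"
  have "(\<lambda>j. (1 / a j) *\<^sub>R (g j *v x0)) \<longlonglongrightarrow> u"
    using tendsto_rescaled_attracting[of x0] orth_limits by (simp add: x0_def u_def axis_def)
  then have "(\<lambda>j. ((1 / a j) *\<^sub>R (g j *v x0)) \<bullet> u) \<longlonglongrightarrow> u \<bullet> u"
    by (intro tendsto_inner tendsto_const)
  then have A: "(\<lambda>j. ((1 / a j) *\<^sub>R (g j *v x0)) \<bullet> u) \<longlonglongrightarrow> 1" by (simp only: u)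
  have B: "(\<lambda>j. (s j *\<^sub>R (g j *v x0)) \<bullet> u) \<longlonglongrightarrow> r"
    unfolding r_def by (intro tendsto_inner tendsto_const assms)
  have "(\<lambda>j. ((s j *\<^sub>R (g j *v x0)) \<bullet> u) / (((1 / a j) *\<^sub>R (g j *v x0)) \<bullet> u)) \<longlonglongrightarrow> r / 1"
    by (intro tendsto_divide A B) simp
  moreover have "\<forall>\<^sub>F j in sequentially. ((s j *\<^sub>R (g j *v x0)) \<bullet> u) / (((1 / a j) *\<^sub>R (g j *v x0)) \<bullet> u) = s j * a j"
    using order_tendstoD(1)[OF A zero_less_one]
  proof eventually_elim
    case (elim j)
    then have "(g j *v x0) \<bullet> u \<noteq> 0" by auto
    then show ?case by simp
  qed
  ultimately have "(\<lambda>j. s j * a j) \<longlonglongrightarrow> r / 1"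
    by (rule Lim_transform_eventually)
  then have "(\<lambda>j. s j * a j) \<longlonglongrightarrow> r" by simp
  then have "(\<lambda>j. (s j * a j) *\<^sub>R ((1 / a j) *\<^sub>R (g j *v x))) \<longlonglongrightarrow> r *\<^sub>R ((l' *v x) $ 1 *\<^sub>R u)"
    unfolding u_def by (intro tendsto_scaleR tendsto_rescaled_attracting)
  moreover have "(\<lambda>j. (s j * a j) *\<^sub>R ((1 / a j) *\<^sub>R (g j *v x))) = (\<lambda>j. s j *\<^sub>R (g j *v x))"
  proof
    fix j
    show "(s j * a j) *\<^sub>R ((1 / a j) *\<^sub>R (g j *v x)) = s j *\<^sub>R (g j *v x)"
      using positive(1)[of j] by simp
  qed
  ultimately have "(\<lambda>j. s j *\<^sub>R (g j *v x)) \<longlonglongrightarrow> r *\<^sub>R ((l' *v x) $ 1 *\<^sub>R u)"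
    by simp
  with assms[of x] have "M x = r *\<^sub>R ((l' *v x) $ 1 *\<^sub>R u)"
    by (rule LIMSEQ_unique)
  then have "transpose l *v (M x) = (r * (l' *v x) $ 1) *\<^sub>R axis 1 1"
    by (simp add: u_def matrix_vector_mult_scaleR orth_limits)
  then show ?thesis by (simp add: attracting_iff axis_def)
qed

text \<open>
  The cubes of \<open>c\<close> and of \<open>1 / a\<close> are products of ratios that tend to zero, because the three
  singular values have product one.
\<close>
lemma extreme_singular_values:
  assumes "\<And>j. a j * b j * c j = 1"
  shows "c \<longlonglongrightarrow> 0" "(\<lambda>j. 1 / a j) \<longlonglongrightarrow> 0"
proof -
  have "(\<lambda>j. (c j / a j) * (c j / b j)) \<longlonglongrightarrow> 0 * 0" by (intro tendsto_mult ratios ratio_outer)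
  moreover have "(\<lambda>j. (c j / a j) * (c j / b j)) = (\<lambda>j. c j ^ 3)"
  proof
    fix j
    show "(c j / a j) * (c j / b j) = c j ^ 3"
      using positive[of j] assms[of j] by (simp add: divide_simps power3_eq_cube) (simp add: algebra_simps)
  qed
  ultimately have "(\<lambda>j. c j ^ 3) \<longlonglongrightarrow> 0" by simp
  then show "c \<longlonglongrightarrow> 0" by (rule cube_tendsto_zero)
  have "(\<lambda>j. (b j / a j) * (c j / a j)) \<longlonglongrightarrow> 0 * 0" by (intro tendsto_mult ratios ratio_outer)
  moreover have "(\<lambda>j. (b j / a j) * (c j / a j)) = (\<lambda>j. (1 / a j) ^ 3)"
  proof
    fix j
    show "(b j / a j) * (c j / a j) = (1 / a j) ^ 3"
      using positive[of j] assms[of j] by (simp add: divide_simps power3_eq_cube) (simp add: algebra_simps)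
  qed
  ultimately have "(\<lambda>j. (1 / a j) ^ 3) \<longlonglongrightarrow> 0" by simp
  then show "(\<lambda>j. 1 / a j) \<longlonglongrightarrow> 0" by (rule cube_tendsto_zero)
qed

text \<open>
  Comparing the third coordinates in \<open>transpose k *v w = diag3 a b c *v (k' *v w)\<close>, a fixed vector has
  a component along the smallest singular direction of size \<open>O(c)\<close>.
\<close>
lemma fixed_vector_in_attracting_plane:
  assumes "c \<longlonglongrightarrow> 0" "\<And>j. g j *v w = w"
  shows "w \<in> snd attracting"
proof -
  have "(transpose (k j) *v w) $ 3 = c j * (k' j *v w) $ 3" for j
  proof -
    have "transpose (k j) *v (g j *v w) = diag3 (a j) (b j) (c j) *v (k' j *v w)"
      by (simp add: action orth)
    then show ?thesis by (simp add: assms diag3_nth)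
  qed
  moreover have "(\<lambda>j. c j * (k' j *v w) $ 3) \<longlonglongrightarrow> 0 * (l' *v w) $ 3"
    by (intro tendsto_intros limits assms)
  moreover have "(\<lambda>j. (transpose (k j) *v w) $ 3) \<longlonglongrightarrow> (transpose l *v w) $ 3"
    by (intro tendsto_intros limits)
  ultimately have "(transpose l *v w) $ 3 = 0" using LIMSEQ_unique by fastforce
  then show ?thesis by (simp add: attracting_iff)
qed

text \<open>
  The dual of the previous argument: the first coordinate of a fixed covector is of size \<open>O(1 / a)\<close>.
\<close>
lemma fixed_covector_kills_attracting_line:
  assumes "(\<lambda>j. 1 / a j) \<longlonglongrightarrow> 0" "\<And>j. transpose (g j) *v w = w" and x: "x \<in> fst attracting"
  shows "w \<bullet> x = 0"
proof -
  have "(transpose (k j) *v w) $ 1 = (1 / a j) * (k' j *v w) $ 1" for j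
  proof -
    have "transpose (diag3 p q r) = diag3 p q r" for p q r
      by (simp add: diag3_def transpose_def vec3_eq_iff)
    then have "transpose (g j) *v w = transpose (k' j) *v (diag3 (a j) (b j) (c j) *v (transpose (k j) *v w))"
      by (simp add: decomposition matrix_transpose_mul matrix_vector_mul_assoc[symmetric])
    then have "k' j *v w = diag3 (a j) (b j) (c j) *v (transpose (k j) *v w)"
      by (metis assms(2) orth(2) orthogonal_cancel(2))
    then show ?thesis using positive[of j] by (simp add: diag3_nth)
  qed
  moreover have "(\<lambda>j. (1 / a j) * (k' j *v w) $ 1) \<longlonglongrightarrow> 0 * (l' *v w) $ 1"
    by (intro tendsto_mult assms tendsto_intros limits)
  moreover have "(\<lambda>j. (transpose (k j) *v w) $ 1) \<longlonglongrightarrow> (transpose l *v w) $ 1"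
    by (intro tendsto_intros limits)
  ultimately have *: "(transpose l *v w) $ 1 = 0" using LIMSEQ_unique by fastforce
  show ?thesis using * x inner_transpose_cancel[OF orth_limits(1), of w x] by (simp add: attracting_iff inner_vec_def sum_3)
qed

end

context cartan_limit begin

text \<open>
  Let \<open>u = l *v (p, q, 0)\<close> be a point of \<open>W\<close> on the attracting plane, with \<open>q \<noteq> 0\<close>. Its perturbation
  \<open>k\<^sub>j *v (p, q, t c\<^sub>j / b\<^sub>j)\<close> is still in \<open>W\<close> for large \<open>j\<close>. The inverse of \<open>g j\<close> multiplies the coordinates
  by \<open>1 / a\<^sub>j\<close>, \<open>1 / b\<^sub>j\<close>, \<open>1 / c\<^sub>j\<close>, so after rescaling by \<open>b\<^sub>j\<close> it sends this point close to the vector with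
  coordinates \<open>(0, q, t)\<close>; here \<open>t\<close> is arbitrary, and such vectors are dense in the repelling plane up to scaling.
\<close>
lemma repelling_plane_subset_closure:
  assumes "open W" and scale: "\<And>x r. x \<in> W \<Longrightarrow> r \<noteq> 0 \<Longrightarrow> r *\<^sub>R x \<in> W"
    and inv: "\<And>j x. g j *v x \<in> W \<Longrightarrow> x \<in> W"
    and u: "u \<in> W" "u \<in> snd attracting"
  shows "snd repelling \<subseteq> closure W"
proof -
  obtain p q where pq: "q \<noteq> 0" "l *v vector [p, q, 0] \<in> W"
  proof (cases "(transpose l *v u) $ 2 = 0")
    case False
    have "vector [(transpose l *v u) $ 1, (transpose l *v u) $ 2, 0] = transpose l *v u"
      using u(2) by (simp add: vec3_eq_iff attracting_iff)
    with False show ?thesis using that u(1) orth_limits(1) by (metis orthogonal_cancel(2))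
  next
    case True
    have *: "vector [(transpose l *v u) $ 1, 0, 0] = transpose l *v u"
      using u(2) True by (simp add: vec3_eq_iff attracting_iff)
    have "(\<lambda>n. l *v vector [(transpose l *v u) $ 1, inverse (real (Suc n)), 0]) \<longlonglongrightarrow>
        l *v vector [(transpose l *v u) $ 1, 0, 0]"
      by (intro tendsto_intros LIMSEQ_inverse_real_of_nat)
    then have "(\<lambda>n. l *v vector [(transpose l *v u) $ 1, inverse (real (Suc n)), 0]) \<longlonglongrightarrow> u"
      using orth_limits(1) by (simp add: *)
    then have "\<forall>\<^sub>F n in sequentially. l *v vector [(transpose l *v u) $ 1, inverse (real (Suc n)), 0] \<in> W"
      using topological_tendstoD assms(1) u(1) by blast
    then obtain n where "l *v vector [(transpose l *v u) $ 1, inverse (real (Suc n)), 0] \<in> W"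
      using eventually_happens'[OF trivial_limit_sequentially] by blast
    then show ?thesis using that[of "inverse (real (Suc n))"] by simp
  qed
  have generic: "transpose l' *v vector [0, q, t] \<in> closure W" for t
  proof -
    define x where "x j = transpose (k' j) *v vector [p * (b j / a j), q, t]" for j
    have "(\<lambda>j. k j *v vector [p, q, t * (c j / b j)]) \<longlonglongrightarrow> l *v vector [p, q, t * 0]"
      by (intro tendsto_intros limits ratios)
    then have ev: "\<forall>\<^sub>F j in sequentially. k j *v vector [p, q, t * (c j / b j)] \<in> W"
      using topological_tendstoD assms(1) pq(2) by fastforce
    have gx: "g j *v x j = b j *\<^sub>R (k j *v vector [p, q, t * (c j / b j)])" for j
    proof -
      have "diag3 (a j) (b j) (c j) *v vector [p * (b j / a j), q, t] =
          b j *\<^sub>R vector [p, q, t * (c j / b j)]"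
        using positive[of j] by (simp add: vec3_eq_iff diag3_nth)
      then show ?thesis by (simp add: action x_def orth matrix_vector_mult_scaleR)
    qed
    from ev have "\<forall>\<^sub>F j in sequentially. x j \<in> W"
    proof eventually_elim
      case (elim j)
      then have "g j *v x j \<in> W" using scale positive(2)[of j] by (simp add: gx)
      then show ?case by (rule inv)
    qed
    moreover have "x \<longlonglongrightarrow> transpose l' *v vector [p * 0, q, t]"
      unfolding x_def by (intro tendsto_intros limits ratios)
    ultimately show ?thesis
      using Lim_in_closed_set[OF closed_closure, of x W sequentially "transpose l' *v vector [p * 0, q, t]"]
        closure_subset[of W] by (simp add: eventually_mono subset_iff)
  qed
  have clscale: "r *\<^sub>R x \<in> closure W" if x: "x \<in> closure W" and r: "r \<noteq> 0" for x r
  proof -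
    obtain y where y: "\<And>n. y n \<in> W" "y \<longlonglongrightarrow> x"
      using x closure_sequential[of x W] by auto
    have "(\<lambda>n. r *\<^sub>R y n) \<longlonglongrightarrow> r *\<^sub>R x" by (intro tendsto_intros y)
    with y(1) scale r show ?thesis unfolding closure_sequential by (intro exI[of _ "\<lambda>n. r *\<^sub>R y n"]) auto
  qed
  have nz: "transpose l' *v vector [0, d, t] \<in> closure W" if "d \<noteq> 0" for d t
  proof -
    have "vector [0, d, t] = (d / q) *\<^sub>R (vector [0, q, t * q / d] :: real^3)"
      using that pq(1) by (simp add: vec3_eq_iff)
    then show ?thesis using clscale[OF generic, of "d / q"] that pq(1) by (simp add: matrix_vector_mult_scaleR)
  qed
  show ?thesis
  proof
    fix y assume "y \<in> snd repelling"
    then have 1: "(l' *v y) $ 1 = 0" by (simp add: repelling_iff)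
    define d where "d = (l' *v y) $ 2"
    define t where "t = (l' *v y) $ 3"
    have "vector [0, d, t] = l' *v y" using 1 by (simp add: vec3_eq_iff d_def t_def)
    then have y: "y = transpose l' *v vector [0, d, t]" using orth_limits(2) by simp
    \<comment> \<open>Points of the repelling plane with \<open>d = 0\<close> are reached as limits; \<open>s\<close> has the sign that moves \<open>d\<close> away from zero.\<close>
    define s :: real where "s = (if d \<ge> 0 then 1 else -1)"
    have "(\<lambda>n. transpose l' *v vector [0, d + s * inverse (real (Suc n)), t]) \<longlonglongrightarrow> transpose l' *v vector [0, d + s * 0, t]"
      by (intro tendsto_intros LIMSEQ_inverse_real_of_nat)
    moreover have "transpose l' *v vector [0, d + s * inverse (real (Suc n)), t] \<in> closure W" for n
    proof (rule nz)
      have "inverse (real (Suc n)) > 0" by simp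
      then show "d + s * inverse (real (Suc n)) \<noteq> 0" unfolding s_def by (smt (verit) mult_cancel_right1 mult_minus_left)
    qed
    ultimately have "transpose l' *v vector [0, d + s * 0, t] \<in> closure W"
      by (intro Lim_in_closed_set[of "closure W"]) auto
    then show "y \<in> closure W" using y by simp
  qed
qed

text \<open>
  The plane with normal \<open>m\<close> does not contain the repelling line, so in the coordinates given by \<open>k' j\<close>
  it is a graph over the first two axes. Above \<open>(p / a\<^sub>j, q / b\<^sub>j)\<close> it has a point with a third coordinate of
  size \<open>O(1 / b\<^sub>j)\<close>, and \<open>g j\<close> maps this point close to \<open>l *v (p, q, 0)\<close>.
\<close>
lemma attracting_plane_subset_closed:
  assumes "closed C" and inv: "\<And>j x. x \<in> C \<Longrightarrow> g j *v x \<in> C"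
    and m: "{x. m \<bullet> x = 0} \<subseteq> C" and z: "z \<in> fst repelling" "m \<bullet> z \<noteq> 0"
  shows "snd attracting \<subseteq> C"
proof
  fix x assume "x \<in> snd attracting"
  define p where "p = (transpose l *v x) $ 1"
  define q where "q = (transpose l *v x) $ 2"
  have "vector [p, q, 0] = transpose l *v x"
    using \<open>x \<in> snd attracting\<close> by (simp add: vec3_eq_iff attracting_iff p_def q_def)
  then have x: "x = l *v vector [p, q, 0]" using orth_limits(1) by simp
  have "m \<bullet> z = (l' *v m) \<bullet> (l' *v z)"
    using inner_transpose_cancel[of "transpose l'" m z] orth_limits(2) by simp
  then have m3: "(l' *v m) $ 3 \<noteq> 0"
    using z by (auto simp: repelling_iff inner_vec_def sum_3)
  define \<mu> where "\<mu> j = k' j *v m" for j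
  have \<mu>: "\<mu> \<longlonglongrightarrow> l' *v m" unfolding \<mu>_def by (intro tendsto_intros limits)
  define e where "e j = - (\<mu> j $ 1 * (p / a j) + \<mu> j $ 2 * (q / b j)) / \<mu> j $ 3" for j
  define y where "y j = transpose (k' j) *v vector [p / a j, q / b j, e j]" for j
  have "\<forall>\<^sub>F j in sequentially. \<mu> j $ 3 \<noteq> 0"
    by (rule tendsto_imp_eventually_ne[OF tendsto_vec_nth[OF \<mu>] m3])
  then have "\<forall>\<^sub>F j in sequentially. g j *v y j \<in> C"
  proof eventually_elim
    case (elim j)
    have "m \<bullet> y j = \<mu> j \<bullet> vector [p / a j, q / b j, e j]"
      using inner_transpose_cancel[of "transpose (k' j)" m "y j"] orth(2)[of j] by (simp add: \<mu>_def y_def)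
    also have "\<dots> = 0" using elim by (simp add: inner_vec_def sum_3 e_def)
    finally show ?case using inv m by auto
  qed
  moreover have "(\<lambda>j. g j *v y j) \<longlonglongrightarrow> x"
  proof -
    have "(\<lambda>j. k j *v vector [p, q, - (\<mu> j $ 1 * p * (c j / a j) + \<mu> j $ 2 * q * (c j / b j)) / \<mu> j $ 3])
        \<longlonglongrightarrow> l *v vector [p, q, - ((l' *v m) $ 1 * p * 0 + (l' *v m) $ 2 * q * 0) / (l' *v m) $ 3]"
      by (intro tendsto_intros limits \<mu> ratios ratio_outer m3)
    moreover have "k j *v vector [p, q, - (\<mu> j $ 1 * p * (c j / a j) + \<mu> j $ 2 * q * (c j / b j)) / \<mu> j $ 3] = g j *v y j" for j
    proof -
      have "diag3 (a j) (b j) (c j) *v vector [p / a j, q / b j, e j] =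
        vector [p, q, - (\<mu> j $ 1 * p * (c j / a j) + \<mu> j $ 2 * q * (c j / b j)) / \<mu> j $ 3]"
        using positive[of j] by (simp add: vec3_eq_iff diag3_nth e_def) (simp add: algebra_simps)
      then show ?thesis by (simp add: action y_def orth)
    qed
    ultimately show ?thesis by (simp add: x)
  qed
  ultimately show "x \<in> C"
    using Lim_in_closed_set[OF assms(1)] by force
qed

end

section \<open>Limit flags of sequences in a regular group\<close>

lemma SL3_singular_values:
  fixes A :: "real^3^3"
  assumes "det A = 1"
  shows "singular_value 1 A \<ge> singular_value 2 A" "singular_value 2 A \<ge> singular_value 3 A"
    "singular_value 3 A > 0" "singular_value 1 A * singular_value 2 A * singular_value 3 A = 1"
proof -
  obtain k k' a b c where *: "orthogonal_matrix k" "orthogonal_matrix k'" "a \<ge> b" "b \<ge> c" "c > 0"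
    "A = k ** diag3 a b c ** k'" using singular_value_decomposition[of A] assms by (metis one_neq_zero)
  then have "singular_values A = [a, b, c]"
    by (intro singular_values_eqI[of k k']) (auto simp: diag3_def)
  then have sv: "singular_value 1 A = a" "singular_value 2 A = b" "singular_value 3 A = c"
    by (simp_all add: singular_value_def)
  have "det (diag3 a b c) = a * b * c" by (simp add: det_3 diag3_def)
  then have "1 = det k * (a * b * c) * det k'" using * assms by (simp add: det_mul)
  moreover have "a * b * c > 0" using * by (intro mult_pos_pos) auto
  ultimately have "a * b * c = 1"
    using det_orthogonal_matrix[OF *(1)] det_orthogonal_matrix[OF *(2)] by auto
  with sv * show "singular_value 1 A \<ge> singular_value 2 A" "singular_value 2 A \<ge> singular_value 3 A"
    "singular_value 3 A > 0" "singular_value 1 A * singular_value 2 A * singular_value 3 A = 1" by auto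
qed

lemma matrix_inv_invertible:
  fixes A :: "real^'n^'n"
  assumes "invertible A"
  shows "A ** matrix_inv A = mat 1" "matrix_inv A ** A = mat 1"
  using assms someI_ex[of "\<lambda>B. A ** B = mat 1 \<and> B ** A = mat 1"]
  unfolding invertible_def matrix_inv_def by blast+

lemma matrix_inv_eqI:
  fixes A B :: "real^'n^'n"
  assumes "A ** B = mat 1"
  shows "matrix_inv A = B"
proof -
  have "invertible A" using assms by (metis invertible_right_inverse)
  then have "matrix_inv A ** A = mat 1" by (rule matrix_inv_invertible)
  then have "matrix_inv A ** (A ** B) = B" by (simp add: matrix_mul_assoc)
  then show ?thesis using assms by simp
qed

lemma subgroup_SL3D:
  assumes "subgroup \<Gamma> SL3"
  shows "A \<in> \<Gamma> \<Longrightarrow> det A = 1" "A \<in> \<Gamma> \<Longrightarrow> B \<in> \<Gamma> \<Longrightarrow> A ** B \<in> \<Gamma>" "A \<in> \<Gamma> \<Longrightarrow> matrix_inv A \<in> \<Gamma>" "mat 1 \<in> \<Gamma>"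
proof -
  interpret G: group SL3 by (rule group_SL3)
  show det: "A \<in> \<Gamma> \<Longrightarrow> det A = 1" for A
    using subgroup.subset[OF assms] by (auto simp: SL3_def)
  show "A \<in> \<Gamma> \<Longrightarrow> B \<in> \<Gamma> \<Longrightarrow> A ** B \<in> \<Gamma>"
    using subgroup.m_closed[OF assms] by (simp add: SL3_def)
  show "mat 1 \<in> \<Gamma>" using subgroup.one_closed[OF assms] by (simp add: SL3_def)
  assume A: "A \<in> \<Gamma>"
  then have "A \<otimes>\<^bsub>SL3\<^esub> inv\<^bsub>SL3\<^esub> A = \<one>\<^bsub>SL3\<^esub>"
    using det by (intro G.r_inv) (simp add: SL3_def)
  then have "A ** inv\<^bsub>SL3\<^esub> A = mat 1" by (simp add: SL3_def)
  then have "matrix_inv A = inv\<^bsub>SL3\<^esub> A" by (rule matrix_inv_eqI)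
  then show "matrix_inv A \<in> \<Gamma>" using subgroup.m_inv_closed[OF assms A] by simp
qed

lemma matrix_inv_decomposition:
  assumes "orthogonal_matrix k" "orthogonal_matrix k'" "a > 0" "b > 0" "c > 0"
  shows "matrix_inv (k ** diag3 a b c ** k') =
    (transpose k' ** reversal3) ** diag3 (1 / c) (1 / b) (1 / a) ** (reversal3 ** transpose k)"
proof (rule matrix_inv_eqI)
  have "diag3 a b c ** diag3 (1 / a) (1 / b) (1 / c) = mat 1"
    using assms by (simp add: diag3_def vec3_eq_iff matrix_matrix_mult_def sum_3 mat_def)
  moreover have "k' ** transpose k' = mat 1" "k ** transpose k = mat 1"
    using assms unfolding orthogonal_matrix_def by auto
  ultimately have "k ** (diag3 a b c ** ((k' ** transpose k') ** diag3 (1 / a) (1 / b) (1 / c))) ** transpose k = mat 1"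
    by (simp only: matrix_mul_lid matrix_mul_rid)
  then show "k ** diag3 a b c ** k' **
    (transpose k' ** reversal3 ** diag3 (1 / c) (1 / b) (1 / a) ** (reversal3 ** transpose k)) = mat 1"
    by (simp only: reversal3_diag3[of "1 / c", symmetric] matrix_mul_assoc)
qed

lemma limit_setI:
  assumes "range \<gamma> \<subseteq> \<Gamma>" "inj \<gamma>" "\<And>j. orthogonal_matrix (k j)" "\<And>j. orthogonal_matrix (k' j)"
    "\<And>j. \<gamma> j = k j ** singular_diag (\<gamma> j) ** k' j"
    "limitin flag_space (\<lambda>j. flag_act (k j) std_flag) F sequentially"
  shows "F \<in> limit_set \<Gamma>"
  unfolding limit_set_def using assms by blast

text \<open>
  The repelling flag belongs to the limit set because it is the attracting flag of the sequence of inverses,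
  whose Cartan decomposition is \<open>matrix_inv_decomposition\<close>.
\<close>
lemma cartan_subsequence:
  fixes \<gamma> k k' :: "nat \<Rightarrow> real^3^3"
  assumes reg: "regular_subgroup \<Gamma>" and \<gamma>: "range \<gamma> \<subseteq> \<Gamma>" "inj \<gamma>"
    and kk': "\<And>j. orthogonal_matrix (k j)" "\<And>j. orthogonal_matrix (k' j)"
      "\<And>j. \<gamma> j = k j ** singular_diag (\<gamma> j) ** k' j"
  obtains r l l' where "strict_mono r"
    "cartan_limit (\<gamma> \<circ> r) (k \<circ> r) (k' \<circ> r) (\<lambda>j. singular_value 1 (\<gamma> (r j)))
       (\<lambda>j. singular_value 2 (\<gamma> (r j))) (\<lambda>j. singular_value 3 (\<gamma> (r j))) l l'"
    "cartan_limit.attracting l \<in> limit_set \<Gamma>" "cartan_limit.repelling l' \<in> limit_set \<Gamma>"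
proof -
  have sub: "subgroup \<Gamma> SL3" using reg by (simp add: regular_subgroup_def discrete_subgroup_def)
  define K where "K = {k :: real^3^3. orthogonal_matrix k} \<times> {k :: real^3^3. orthogonal_matrix k}"
  define f where "f j = (k j, k' j)" for j
  have cpt: "compact K"
    unfolding K_def by (intro compact_Times compact_orthogonal_matrices)
  have fK: "\<forall>j. f j \<in> K" using kk' by (simp add: K_def f_def)
  obtain L r where L: "L \<in> K" and r: "strict_mono r" and lim: "(f \<circ> r) \<longlonglongrightarrow> L"
    using compact_def[of K, THEN iffD1, OF cpt, THEN spec, THEN mp, OF fK] by metis
  obtain l l' where LL: "L = (l, l')" by fastforce
  have lo: "orthogonal_matrix l" "orthogonal_matrix l'" using L LL by (auto simp: K_def)
  have kl: "(k \<circ> r) \<longlonglongrightarrow> l" "(k' \<circ> r) \<longlonglongrightarrow> l'"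
    using tendsto_fst[OF lim] tendsto_snd[OF lim] by (simp_all add: LL f_def o_def)
  have injr: "inj r" using r by (rule strict_mono_imp_inj_on)
  have \<gamma>r: "range (\<gamma> \<circ> r) \<subseteq> \<Gamma>" "inj (\<gamma> \<circ> r)" using \<gamma> injr by (auto intro: inj_compose)
  have det: "det (\<gamma> j) = 1" for j using \<gamma>(1) subgroup_SL3D(1)[OF sub] by blast
  have diag: "singular_diag A = diag3 (singular_value 1 A) (singular_value 2 A) (singular_value 3 A)" for A
    by (simp add: singular_diag_def diag3_def)
  have pos: "singular_value 1 (\<gamma> j) > 0" "singular_value 2 (\<gamma> j) > 0" "singular_value 3 (\<gamma> j) > 0" for j
    using SL3_singular_values[OF det[of j]] by auto
  have rat: "\<forall>i\<in>{1, 2}. filterlim (\<lambda>j. singular_value i ((\<gamma> \<circ> r) j) / singular_value (i + 1) ((\<gamma> \<circ> r) j)) at_top sequentially"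
    using reg \<gamma>r unfolding regular_subgroup_def by blast
  have inv_rat: "(\<lambda>j. singular_value (i + 1) (\<gamma> (r j)) / singular_value i (\<gamma> (r j))) \<longlonglongrightarrow> 0" if "i \<in> {1, 2}" for i
    using tendsto_inverse_0_at_top[OF rat[rule_format, OF that]] by (simp add: o_def)
  interpret cartan_limit "\<gamma> \<circ> r" "k \<circ> r" "k' \<circ> r" "\<lambda>j. singular_value 1 (\<gamma> (r j))"
       "\<lambda>j. singular_value 2 (\<gamma> (r j))" "\<lambda>j. singular_value 3 (\<gamma> (r j))" l l'
  proof
    show "(\<gamma> \<circ> r) j = (k \<circ> r) j ** diag3 (singular_value 1 (\<gamma> (r j))) (singular_value 2 (\<gamma> (r j)))
      (singular_value 3 (\<gamma> (r j))) ** (k' \<circ> r) j" for j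
      using kk'(3)[of "r j"] by (simp add: diag)
    show "(\<lambda>j. singular_value 2 (\<gamma> (r j)) / singular_value 1 (\<gamma> (r j))) \<longlonglongrightarrow> 0"
      "(\<lambda>j. singular_value 3 (\<gamma> (r j)) / singular_value 2 (\<gamma> (r j))) \<longlonglongrightarrow> 0"
      using inv_rat[of 1] inv_rat[of 2] by (simp_all add: numeral_eq_Suc)
  qed (use kk' pos lo kl in auto)
  have "limitin flag_space (\<lambda>j. flag_act ((k \<circ> r) j) std_flag) attracting sequentially"
    unfolding attracting_def
    by (intro limitin_flag_act kl orthogonal_imp_invertible lo) (simp add: kk')
  then have att: "attracting \<in> limit_set \<Gamma>"
    using \<gamma>r kk' by (intro limit_setI[of "\<gamma> \<circ> r" _ "k \<circ> r" "k' \<circ> r"]) auto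
  define \<delta> where "\<delta> j = matrix_inv (\<gamma> (r j))" for j
  define h where "h j = transpose (k' (r j)) ** reversal3" for j
  define h' where "h' j = reversal3 ** transpose (k (r j))" for j
  have ho: "orthogonal_matrix (h j)" "orthogonal_matrix (h' j)" for j
    unfolding h_def h'_def by (intro orthogonal_matrix_mul orthogonal_reversal3; simp add: kk')+
  have \<delta>eq: "\<delta> j = h j ** diag3 (1 / singular_value 3 (\<gamma> (r j))) (1 / singular_value 2 (\<gamma> (r j)))
      (1 / singular_value 1 (\<gamma> (r j))) ** h' j" for j
    unfolding \<delta>_def h_def h'_def
    using arg_cong[OF kk'(3)[of "r j", unfolded diag], of matrix_inv]
      matrix_inv_decomposition[OF kk'(1)[of "r j"] kk'(2)[of "r j"] pos]
    by (rule trans)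
  have "singular_values (\<delta> j) = [1 / singular_value 3 (\<gamma> (r j)), 1 / singular_value 2 (\<gamma> (r j)),
      1 / singular_value 1 (\<gamma> (r j))]" for j
    using \<delta>eq[of j] SL3_singular_values[OF det[of "r j"]] pos[of "r j"] ho[of j]
    by (intro singular_values_eqI[of "h j" "h' j"]) (auto simp: diag3_def frac_le)
  then have "singular_diag (\<delta> j) = diag3 (1 / singular_value 3 (\<gamma> (r j))) (1 / singular_value 2 (\<gamma> (r j)))
      (1 / singular_value 1 (\<gamma> (r j)))" for j
    unfolding diag singular_value_def[of _ "\<delta> j"] by simp
  with \<delta>eq have \<delta>sd: "\<delta> j = h j ** singular_diag (\<delta> j) ** h' j" for j by presburger
  have "range \<delta> \<subseteq> \<Gamma>" using \<gamma> subgroup_SL3D(3)[OF sub] by (auto simp: \<delta>_def)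
  moreover have "inj \<delta>"
  proof (rule injI)
    fix i j assume "\<delta> i = \<delta> j"
    moreover have "\<gamma> (r n) ** \<delta> n = mat 1" "\<delta> n ** \<gamma> (r n) = mat 1" for n
      unfolding \<delta>_def using det by (simp_all add: invertible_det_nz matrix_inv_invertible)
    ultimately have "\<gamma> (r i) = \<gamma> (r j)" by (metis matrix_mul_assoc matrix_mul_lid matrix_mul_rid)
    then show "i = j" using \<gamma>r(2) by (simp add: inj_eq[OF \<gamma>(2)] inj_eq[OF injr])
  qed
  moreover have "limitin flag_space (\<lambda>j. flag_act (h j) std_flag) repelling sequentially"
    unfolding repelling_def
  proof (intro limitin_flag_act orthogonal_imp_invertible ho)
    show "h \<longlonglongrightarrow> transpose l' ** reversal3"
      unfolding h_def using kl(2) by (intro tendsto_intros) (simp add: o_def)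
    show "orthogonal_matrix (transpose l' ** reversal3)"
      by (intro orthogonal_matrix_mul orthogonal_reversal3) (simp add: lo)
  qed
  ultimately have "repelling \<in> limit_set \<Gamma>"
    using \<delta>sd ho by (intro limit_setI[of \<delta> _ h h'])
  with that[OF r] att cartan_limit_axioms show ?thesis by blast
qed

text \<open>
  The bilinear form of the orthogonal projection onto the normal line of the plane of a flag. It is
  independent of the choice of the normal vector, and continuous in the flag. It vanishes on
  \<open>(p, q)\<close> exactly if \<open>p\<close> or \<open>q\<close> lies on the plane.
\<close>
definition plane_pairing :: "real^3 \<Rightarrow> real^3 \<Rightarrow> flag \<Rightarrow> real" where
  "plane_pairing p q F = (let n = (SOME n. n \<noteq> 0 \<and> snd F = {x. n \<bullet> x = 0}) in (n \<bullet> p) * (n \<bullet> q) / (n \<bullet> n))"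

lemma plane_pairing_eq:
  assumes n: "n \<noteq> 0" "snd F = {x. n \<bullet> x = 0}"
  shows "plane_pairing p q F = (n \<bullet> p) * (n \<bullet> q) / (n \<bullet> n)"
proof -
  define m where "m = (SOME n. n \<noteq> 0 \<and> snd F = {x. n \<bullet> x = 0})"
  have "m \<noteq> 0 \<and> snd F = {x. m \<bullet> x = 0}"
    unfolding m_def by (rule someI_ex) (use n in blast)
  then have m: "m \<noteq> 0" "\<And>x. m \<bullet> x = 0 \<longleftrightarrow> n \<bullet> x = 0" using n(2) by auto
  define r where "r = (m \<bullet> n) / (n \<bullet> n)"
  define d where "d = m - r *\<^sub>R n"
  have "n \<bullet> d = 0" using n(1) by (simp add: d_def r_def inner_diff_right inner_commute)
  moreover from this have "m \<bullet> d = 0" using m(2) by simp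
  ultimately have "d \<bullet> d = 0" by (simp add: d_def inner_diff_left)
  then have mr: "m = r *\<^sub>R n" by (simp add: d_def)
  then have "r \<noteq> 0" using m(1) by auto
  have "plane_pairing p q F = (m \<bullet> p) * (m \<bullet> q) / (m \<bullet> m)"
    by (simp add: plane_pairing_def m_def[symmetric])
  also have "\<dots> = (n \<bullet> p) * (n \<bullet> q) / (n \<bullet> n)"
    using \<open>r \<noteq> 0\<close> by (simp add: mr)
  finally show ?thesis .
qed

text \<open>
  The cross product of the first two columns is a normal vector of the plane that depends
  continuously on the matrix.
\<close>
lemma snd_flag_act_std_flag:
  assumes "invertible A"
  shows "cross3 (A *v axis 1 1) (A *v axis 2 1) \<noteq> 0"
    and "snd (flag_act A std_flag) = {x. cross3 (A *v axis 1 1) (A *v axis 2 1) \<bullet> x = 0}"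
proof -
  define n where "n = cross3 (A *v axis 1 1) (A *v axis 2 1)"
  have d: "det A \<noteq> 0" using assms by (simp add: invertible_det_nz)
  have An: "transpose A *v n = det A *\<^sub>R axis 3 1"
    unfolding n_def by (simp add: cross_matrix_mult cross_basis)
  have n: "n \<bullet> (A *v x) = det A * x $ 3" for x
  proof -
    have "n \<bullet> (A *v x) = (transpose A *v n) \<bullet> x"
      by (simp add: transpose_matrix_vector dot_lmul_matrix)
    then show ?thesis by (simp add: An inner_axis')
  qed
  show "cross3 (A *v axis 1 1) (A *v axis 2 1) \<noteq> 0"
    using n[of "axis 3 1"] d unfolding n_def[symmetric] by auto
  have surj: "\<exists>y. x = A *v y" for x
    using assms matrix_inv_invertible(1)[OF assms] by (metis matrix_vector_mul_assoc matrix_vector_mul_lid)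
  have "snd (flag_act A std_flag) = (*v) A ` {x. x $ 3 = 0}"
    by (simp add: flag_act_def std_flag_def span_axis_3)
  also have "\<dots> = {x. n \<bullet> x = 0}"
    using n d surj by (auto simp: image_iff) (metis mult_eq_0_iff)
  finally show "snd (flag_act A std_flag) = {x. cross3 (A *v axis 1 1) (A *v axis 2 1) \<bullet> x = 0}"
    by (simp add: n_def)
qed

lemma flag_plane_normal:
  assumes "F \<in> topspace flag_space"
  obtains n where "n \<noteq> 0" "snd F = {x. n \<bullet> x = 0}"
proof -
  obtain A :: "real^3^3" where "invertible A" "F = flag_act A std_flag"
    using assms by (auto simp: flag_space_def topspace_quotient_topology)
  with snd_flag_act_std_flag[of A] that show ?thesis by blast
qed

lemma continuous_map_plane_pairing: "continuous_map flag_space euclideanreal (plane_pairing p q)"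
  unfolding flag_space_def
proof (rule continuous_compose_quotient_map[OF quotient_map_quotient_topology])
  define n where "n A = cross3 (A *v axis 1 1) (A *v axis 2 1)" for A :: "real^3^3"
  have "continuous_on {A. invertible A} (\<lambda>A :: real^3^3. A *v x)" for x
    by (auto simp: continuous_on_def intro!: tendsto_intros)
  then have "continuous_on {A. invertible A} n"
    unfolding n_def by (intro continuous_on_cross)
  then have "continuous_on {A. invertible A} (\<lambda>A. (n A \<bullet> p) * (n A \<bullet> q) / (n A \<bullet> n A))"
    using snd_flag_act_std_flag(1) by (intro continuous_intros) (auto simp: n_def)
  then show "continuous_map (top_of_set {A. invertible A}) euclideanreal
      (plane_pairing p q \<circ> (\<lambda>A. flag_act A std_flag))"
    using plane_pairing_eq[OF snd_flag_act_std_flag]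
    by (simp add: n_def o_def cong: continuous_on_cong_simp)
qed

lemma plane_pairing_eq_0_iff:
  assumes "F \<in> topspace flag_space"
  shows "plane_pairing p q F = 0 \<longleftrightarrow> p \<in> snd F \<or> q \<in> snd F"
proof -
  obtain n where n: "n \<noteq> 0" "snd F = {x. n \<bullet> x = 0}" using flag_plane_normal[OF assms] .
  then show ?thesis by (simp add: plane_pairing_eq[OF n])
qed

lemma limit_set_subset_flag_space: "limit_set \<Gamma> \<subseteq> topspace flag_space"
  unfolding limit_set_def by (auto dest: limitin_topspace)

text \<open>
  The flag \<open>F\<close> and the attracting flag of the extracted subsequence are limits of the same sequence, and the
  continuous functions \<open>plane_pairing x x\<close> determine their planes.
\<close>
lemma limit_set_cartan_limit:
  assumes reg: "regular_subgroup \<Gamma>" and F: "F \<in> limit_set \<Gamma>"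
  obtains g k k' a b c l l' where "cartan_limit g k k' a b c l l'" "range g \<subseteq> \<Gamma>"
    "snd (cartan_limit.attracting l) = snd F" "cartan_limit.repelling l' \<in> limit_set \<Gamma>"
proof -
  obtain \<gamma> k k' where \<gamma>: "range \<gamma> \<subseteq> \<Gamma>" "inj \<gamma>"
    and kk': "\<And>j. orthogonal_matrix (k j)" "\<And>j. orthogonal_matrix (k' j)"
      "\<And>j. \<gamma> j = k j ** singular_diag (\<gamma> j) ** k' j"
    and lim: "limitin flag_space (\<lambda>j. flag_act (k j) std_flag) F sequentially"
    using F unfolding limit_set_def by blast
  obtain r l l' where r: "strict_mono r" and C: "cartan_limit (\<gamma> \<circ> r) (k \<circ> r) (k' \<circ> r) (\<lambda>j. singular_value 1 (\<gamma> (r j)))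
       (\<lambda>j. singular_value 2 (\<gamma> (r j))) (\<lambda>j. singular_value 3 (\<gamma> (r j))) l l'"
    and rep: "cartan_limit.repelling l' \<in> limit_set \<Gamma>"
    using cartan_subsequence[OF reg \<gamma> kk'] by blast
  interpret cartan_limit "\<gamma> \<circ> r" "k \<circ> r" "k' \<circ> r" "\<lambda>j. singular_value 1 (\<gamma> (r j))"
       "\<lambda>j. singular_value 2 (\<gamma> (r j))" "\<lambda>j. singular_value 3 (\<gamma> (r j))" l l' by (rule C)
  have lim1: "limitin flag_space (\<lambda>j. flag_act (k (r j)) std_flag) F sequentially"
    using limitin_subsequence[OF r lim] by (simp add: o_def)
  have lim2: "limitin flag_space (\<lambda>j. flag_act (k (r j)) std_flag) attracting sequentially"
    unfolding attracting_def using limits(1)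
    by (intro limitin_flag_act orthogonal_imp_invertible orth_limits kk') (simp add: o_def)
  have eq: "plane_pairing x x F = plane_pairing x x attracting" for x
    using continuous_map_limit[OF continuous_map_plane_pairing[of x x] lim1]
      continuous_map_limit[OF continuous_map_plane_pairing[of x x] lim2]
    by (simp add: LIMSEQ_unique)
  have "snd attracting = snd F"
    using plane_pairing_eq_0_iff[OF limitin_topspace[OF lim1]] plane_pairing_eq_0_iff[OF limitin_topspace[OF lim2]] eq
    by (metis subsetI subset_antisym)
  moreover have "range (\<gamma> \<circ> r) \<subseteq> \<Gamma>" using \<gamma>(1) by auto
  ultimately show ?thesis using that C rep by blast
qed

lemma regular_sequence_cartan_limit:
  fixes \<gamma> :: "nat \<Rightarrow> real^3^3"
  assumes reg: "regular_subgroup \<Gamma>" and \<gamma>: "range \<gamma> \<subseteq> \<Gamma>" "inj \<gamma>"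
  obtains r k k' a b c l l' where "strict_mono r" "cartan_limit (\<gamma> \<circ> r) k k' a b c l l'"
    "\<And>j. a j * b j * c j = 1" "cartan_limit.attracting l \<in> limit_set \<Gamma>"
proof -
  have det: "det (\<gamma> j) = 1" for j
    using \<gamma>(1) subgroup_SL3D(1) reg by (auto simp: regular_subgroup_def discrete_subgroup_def)
  have "\<exists>k k'. orthogonal_matrix k \<and> orthogonal_matrix k' \<and> \<gamma> j = k ** singular_diag (\<gamma> j) ** k'" for j
    using SL3_singular_diag[OF det[of j]] by metis
  then obtain k k' where kk': "\<And>j. orthogonal_matrix (k j)" "\<And>j. orthogonal_matrix (k' j)"
      "\<And>j. \<gamma> j = k j ** singular_diag (\<gamma> j) ** k' j"
    by metis
  obtain r l l' where *: "strict_mono r" "cartan_limit (\<gamma> \<circ> r) (k \<circ> r) (k' \<circ> r) (\<lambda>j. singular_value 1 (\<gamma> (r j)))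
       (\<lambda>j. singular_value 2 (\<gamma> (r j))) (\<lambda>j. singular_value 3 (\<gamma> (r j))) l l'"
    "cartan_limit.attracting l \<in> limit_set \<Gamma>"
    using cartan_subsequence[OF reg \<gamma> kk'] by blast
  show ?thesis using that[OF *(1,2) SL3_singular_values(4)[OF det] *(3)] .
qed

lemma limit_flag_containing_range:
  fixes \<gamma> :: "nat \<Rightarrow> real^3^3" and M :: "real^3 \<Rightarrow> real^3"
  assumes "regular_subgroup \<Gamma>" "range \<gamma> \<subseteq> \<Gamma>" "inj \<gamma>"
    and lim: "\<And>x. (\<lambda>j. s j *\<^sub>R (\<gamma> j *v x)) \<longlonglongrightarrow> M x"
  obtains X where "X \<in> limit_set \<Gamma>" "\<And>x. M x \<in> fst X"
proof -
  obtain r k k' a b c l l' where r: "strict_mono r" and C: "cartan_limit (\<gamma> \<circ> r) k k' a b c l l'"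
    and att: "cartan_limit.attracting l \<in> limit_set \<Gamma>"
    using regular_sequence_cartan_limit[OF assms(1-3)] by metis
  have "(\<lambda>j. s (r j) *\<^sub>R ((\<gamma> \<circ> r) j *v x)) \<longlonglongrightarrow> M x" for x
    using LIMSEQ_subseq_LIMSEQ[OF lim r] by (simp add: o_def)
  then have "M x \<in> fst (cartan_limit.attracting l)" for x
    by (rule cartan_limit.range_limit_subset_attracting_line[OF C, where s = "\<lambda>j. s (r j)"])
  with that att show ?thesis by blast
qed

text \<open>
  For \<open>\<delta> \<in> \<Gamma>\<close> the sequence \<open>\<delta> ** \<gamma> j\<close> has rank-one limit with image spanned by \<open>\<delta> *v v\<close>, which is therefore
  on the line of a limit flag. The application is to sequences in \<open>\<Gamma> \<inter> H\<close>, which fix a vector \<open>w\<close> and a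
  covector \<open>\<eta>\<close>.
\<close>
lemma invariant_limit_flag:
  fixes \<gamma> :: "nat \<Rightarrow> real^3^3"
  assumes reg: "regular_subgroup \<Gamma>" and \<gamma>: "range \<gamma> \<subseteq> \<Gamma>" "inj \<gamma>"
    and fixed: "\<And>j. \<gamma> j *v w = w" "\<And>j. transpose (\<gamma> j) *v \<eta> = \<eta>"
  obtains v X where "v \<noteq> 0" "\<eta> \<bullet> v = 0" "X \<in> limit_set \<Gamma>" "v \<in> fst X" "w \<in> snd X"
    "\<forall>\<delta>\<in>\<Gamma>. \<exists>Y\<in>limit_set \<Gamma>. \<delta> *v v \<in> fst Y"
proof -
  have sub: "subgroup \<Gamma> SL3" using reg by (simp add: regular_subgroup_def discrete_subgroup_def)
  obtain r k k' a b c l l' where r: "strict_mono r" and C: "cartan_limit (\<gamma> \<circ> r) k k' a b c l l'"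
    and abc: "\<And>j. a j * b j * c j = 1" and att: "cartan_limit.attracting l \<in> limit_set \<Gamma>"
    using regular_sequence_cartan_limit[OF reg \<gamma>] by metis
  interpret cartan_limit "\<gamma> \<circ> r" k k' a b c l l' by (rule C)
  define v where "v = l *v axis 1 1"
  have v: "transpose l *v v = axis 1 1" using orth_limits(1) by (simp add: v_def)
  have "v \<noteq> 0"
  proof
    assume "v = 0"
    then have "axis 1 1 = (0 :: real^3)" using v by simp
    then show False by (simp add: axis_eq_0_iff)
  qed
  have vX: "v \<in> fst attracting" by (simp add: attracting_iff v axis_def)
  have "\<eta> \<bullet> v = 0"
    using fixed_covector_kills_attracting_line[OF extreme_singular_values(2)[OF abc] _ vX] fixed by simp
  have "w \<in> snd attracting"
    using fixed_vector_in_attracting_plane[OF extreme_singular_values(1)[OF abc]] fixed by simp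
  have "\<exists>Y\<in>limit_set \<Gamma>. \<delta> *v v \<in> fst Y" if \<delta>: "\<delta> \<in> \<Gamma>" for \<delta>
  proof -
    define \<beta> where "\<beta> j = \<delta> ** \<gamma> (r j)" for j
    have inv: "matrix_inv \<delta> ** \<delta> = mat 1"
      using subgroup_SL3D(1)[OF sub \<delta>] by (simp add: invertible_det_nz matrix_inv_invertible)
    have "range \<beta> \<subseteq> \<Gamma>" using \<gamma>(1) subgroup_SL3D(2)[OF sub \<delta>] by (auto simp: \<beta>_def)
    moreover have "inj \<beta>"
    proof (rule injI)
      fix i j assume "\<beta> i = \<beta> j"
      then have "matrix_inv \<delta> ** \<beta> i = matrix_inv \<delta> ** \<beta> j" by simp
      then have "\<gamma> (r i) = \<gamma> (r j)" unfolding \<beta>_def by (simp add: matrix_mul_assoc inv)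
      then show "i = j" using \<gamma>(2) strict_mono_imp_inj_on[OF r] by (simp add: inj_eq)
    qed
    moreover have "(\<lambda>j. (1 / a j) *\<^sub>R (\<beta> j *v x)) \<longlonglongrightarrow> (l' *v x) $ 1 *\<^sub>R (\<delta> *v v)" for x
    proof -
      have "(\<lambda>j. \<delta> *v ((1 / a j) *\<^sub>R ((\<gamma> \<circ> r) j *v x))) \<longlonglongrightarrow> \<delta> *v ((l' *v x) $ 1 *\<^sub>R v)"
        unfolding v_def by (intro tendsto_matrix_vector_mult tendsto_const tendsto_rescaled_attracting)
      then show ?thesis by (simp add: \<beta>_def matrix_vector_mult_scaleR matrix_vector_mul_assoc)
    qed
    ultimately obtain Y where Y: "Y \<in> limit_set \<Gamma>" "\<And>x. (l' *v x) $ 1 *\<^sub>R (\<delta> *v v) \<in> fst Y"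
      using limit_flag_containing_range[OF reg, of \<beta> "\<lambda>j. 1 / a j" "\<lambda>x. (l' *v x) $ 1 *\<^sub>R (\<delta> *v v)"] by blast
    have "\<delta> *v v \<in> fst Y"
      using Y(2)[of "transpose l' *v axis 1 1"] orth_limits(2) by (simp add: axis_def)
    with Y(1) show ?thesis by blast
  qed
  with that \<open>v \<noteq> 0\<close> \<open>\<eta> \<bullet> v = 0\<close> att vX \<open>w \<in> snd attracting\<close> show ?thesis by blast
qed

section \<open>The planes of an antipodal circle of flags\<close>

lemma flag_line_subset:
  assumes "X \<in> flags" "v \<in> fst X" "v \<noteq> 0" "subspace S" "v \<in> S"
  shows "fst X \<subseteq> S"
proof -
  have "dim (fst X) \<le> dim {v}" using assms(1,3) by (auto simp: flags_def dim_eq_card_independent)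
  then have "span {v} = span (fst X)" using assms(2) by (intro dim_eq_span) auto
  then have "fst X \<subseteq> span {v}" using span_superset by blast
  also have "span {v} \<subseteq> S" using assms(4,5) by (intro span_minimal) auto
  finally show ?thesis .
qed

lemma connectedin_circle_minus_point:
  assumes X: "topological_circle X" and x: "x \<in> topspace X"
  shows "connectedin X (topspace X - {x})"
proof -
  let ?C = "sphere (0 :: real^2) 1"
  have "top_of_set ?C homeomorphic_space X"
    using X unfolding topological_circle_def by (subst homeomorphic_space_sym)
  then obtain h where h: "homeomorphic_map (top_of_set ?C) X h"
    using homeomorphic_space[of "top_of_set ?C" X] by blast
  have im: "h ` ?C = topspace X" and inj: "inj_on h ?C" and cont: "continuous_map (top_of_set ?C) X h"
    using h by (auto simp: homeomorphic_eq_everything_map)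
  obtain y where y: "y \<in> ?C" "h y = x" using im x by (metis imageE)
  have "connected (?C - {y})"
  proof -
    obtain b :: "real^2" where "b \<noteq> 0" using one_neq_zero by blast
    then have "(?C - {y}) homeomorphic {x. b \<bullet> x = 0}"
      using y by (intro homeomorphic_punctured_sphere_hyperplane) auto
    then show ?thesis
      using homeomorphic_connectedness[of "?C - {y}"] convex_connected[OF convex_hyperplane[of b 0]] by blast
  qed
  then have "connectedin (top_of_set ?C) (?C - {y})" by (simp add: connectedin_subtopology)
  then have "connectedin X (h ` (?C - {y}))" by (rule connectedin_continuous_map_image[OF cont])
  moreover have "h ` (?C - {y}) = topspace X - {x}"
    using im inj y by (auto simp: inj_on_def)
  ultimately show ?thesis by simp
qed

lemma plane_pairing_constant_sign:
  assumes circle: "topological_circle (subtopology flag_space \<Lambda>)" and \<Lambda>: "\<Lambda> \<subseteq> topspace flag_space"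
    and X: "X \<in> \<Lambda>" and F: "F \<in> \<Lambda> - {X}" and G: "G \<in> \<Lambda> - {X}"
    and nz: "\<And>F. F \<in> \<Lambda> - {X} \<Longrightarrow> plane_pairing p q F \<noteq> 0"
  shows "plane_pairing p q F * plane_pairing p q G > 0"
proof (rule ccontr)
  assume neg: "\<not> plane_pairing p q F * plane_pairing p q G > 0"
  have top: "topspace (subtopology flag_space \<Lambda>) = \<Lambda>" using \<Lambda> by auto
  have "connectedin (subtopology flag_space \<Lambda>) (\<Lambda> - {X})"
    using connectedin_circle_minus_point[OF circle, unfolded top, OF X] .
  then have "connectedin euclideanreal (plane_pairing p q ` (\<Lambda> - {X}))"
    by (rule connectedin_continuous_map_image[OF continuous_map_from_subtopology[OF continuous_map_plane_pairing]])
  then have "is_interval (plane_pairing p q ` (\<Lambda> - {X}))"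
    by (simp add: is_interval_connected_1)
  moreover have "plane_pairing p q F \<in> plane_pairing p q ` (\<Lambda> - {X})"
    "plane_pairing p q G \<in> plane_pairing p q ` (\<Lambda> - {X})" using F G by auto
  moreover have "(plane_pairing p q F \<le> 0 \<and> 0 \<le> plane_pairing p q G) \<or> (plane_pairing p q G \<le> 0 \<and> 0 \<le> plane_pairing p q F)"
    using neg by (smt (verit) mult_pos_pos mult_neg_neg)
  ultimately have "0 \<in> plane_pairing p q ` (\<Lambda> - {X})"
    unfolding is_interval_1 by blast
  then show False using nz by force
qed

text \<open>
  If \<open>p\<close> were on no plane, the functions \<open>plane_pairing p v\<^sub>i\<close> would vanish only at \<open>X\<^sub>i\<close> and have
  constant sign elsewhere. The linear relation at \<open>X1\<close> makes \<open>b\<close> times the second and \<open>c\<close> times the third function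
  opposite in sign, and likewise for the other two pairs; but three nonzero numbers cannot have pairwise opposite signs.
\<close>
lemma dependent_antipodal_circle_planes_cover:
  assumes circle: "topological_circle (subtopology flag_space \<Lambda>)" and \<Lambda>: "\<Lambda> \<subseteq> topspace flag_space"
    and antipodal: "\<And>F G. F \<in> \<Lambda> \<Longrightarrow> G \<in> \<Lambda> \<Longrightarrow> F \<noteq> G \<Longrightarrow> transverse F G"
    and X: "X1 \<in> \<Lambda>" "X2 \<in> \<Lambda>" "X3 \<in> \<Lambda>" "X1 \<noteq> X2" "X1 \<noteq> X3" "X2 \<noteq> X3"
    and v: "v1 \<in> fst X1" "v2 \<in> fst X2" "v3 \<in> fst X3" "v1 \<noteq> 0" "v2 \<noteq> 0" "v3 \<noteq> 0"
    and rel: "a *\<^sub>R v1 + b *\<^sub>R v2 + c *\<^sub>R v3 = 0" "a \<noteq> 0" "b \<noteq> 0" "c \<noteq> 0"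
  shows "\<exists>F\<in>\<Lambda>. p \<in> snd F"
proof (rule ccontr)
  assume p: "\<not> (\<exists>F\<in>\<Lambda>. p \<in> snd F)"
  have fl: "F \<in> flags" if "F \<in> \<Lambda>" for F using that \<Lambda> topspace_flag_space by blast
  have mem: "v \<in> snd F \<longleftrightarrow> F = X" if "X \<in> \<Lambda>" "v \<in> fst X" "v \<noteq> 0" "F \<in> \<Lambda>" for X F v
  proof
    assume "v \<in> snd F"
    then have "fst X \<subseteq> snd F"
      using fl[OF that(4)] by (intro flag_line_subset[OF fl[OF that(1)] that(2,3)]) (auto simp: flags_def)
    then show "F = X" using antipodal[OF that(1,4)] by (auto simp: transverse_def)
  next
    assume "F = X"
    then show "v \<in> snd F" using fl[OF that(1)] that(2) by (auto simp: flags_def)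
  qed
  have zero: "plane_pairing p v F = 0 \<longleftrightarrow> F = X" if "X \<in> \<Lambda>" "v \<in> fst X" "v \<noteq> 0" "F \<in> \<Lambda>" for X F v
    using plane_pairing_eq_0_iff[of F p v] mem[OF that] p that(4) \<Lambda> by blast
  have pos: "plane_pairing p v F * plane_pairing p v G > 0"
    if "X \<in> \<Lambda>" "v \<in> fst X" "v \<noteq> 0" "F \<in> \<Lambda> - {X}" "G \<in> \<Lambda> - {X}" for X F G v
    using that zero[OF that(1-3)] by (intro plane_pairing_constant_sign[OF circle \<Lambda> that(1,4,5)]) blast
  have lin: "a * plane_pairing p v1 F + b * plane_pairing p v2 F + c * plane_pairing p v3 F = 0" if F: "F \<in> \<Lambda>" for F
  proof -
    obtain n where n: "n \<noteq> 0" "snd F = {x. n \<bullet> x = 0}" using flag_plane_normal[of F] F \<Lambda> by blast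
    have "a * plane_pairing p v1 F + b * plane_pairing p v2 F + c * plane_pairing p v3 F =
        (n \<bullet> p) * (n \<bullet> (a *\<^sub>R v1 + b *\<^sub>R v2 + c *\<^sub>R v3)) / (n \<bullet> n)"
      by (simp add: plane_pairing_eq[OF n] inner_add_right algebra_simps add_divide_distrib)
    then show ?thesis by (simp add: rel)
  qed
  define A2 A3 B1 B3 C1 C2 where "A2 = a * plane_pairing p v1 X2" and "A3 = a * plane_pairing p v1 X3"
    and "B1 = b * plane_pairing p v2 X1" and "B3 = b * plane_pairing p v2 X3"
    and "C1 = c * plane_pairing p v3 X1" and "C2 = c * plane_pairing p v3 X2"
  have sums: "B1 + C1 = 0" "A2 + C2 = 0" "A3 + B3 = 0"
    using lin[OF X(1)] lin[OF X(2)] lin[OF X(3)] zero[OF X(1) v(1,4) X(1)] zero[OF X(2) v(2,5) X(2)] zero[OF X(3) v(3,6) X(3)]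
    by (simp_all add: A2_def A3_def B1_def B3_def C1_def C2_def)
  have sq: "(r * x) * (r * y) > 0" if "x * y > 0" "r \<noteq> 0" for r x y :: real
  proof -
    have "(r * x) * (r * y) = r\<^sup>2 * (x * y)" by (simp add: power2_eq_square)
    also have "\<dots> > 0" using that by (intro mult_pos_pos[OF _ that(1)]) simp
    finally show ?thesis .
  qed
  have "A2 * A3 > 0" unfolding A2_def A3_def
    using X by (intro sq rel(2) pos[OF X(1) v(1,4)]) auto
  moreover have "B1 * B3 > 0" unfolding B1_def B3_def
    using X by (intro sq rel(3) pos[OF X(2) v(2,5)]) auto
  moreover have "C1 * C2 > 0" unfolding C1_def C2_def
    using X by (intro sq rel(4) pos[OF X(3) v(3,6)]) auto
  ultimately show False
    using sums by (auto simp: zero_less_mult_iff)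
qed

section \<open>Zariski-dense subgroups of a reducible copy of SL(2)\<close>

lemma real_polynomial_matrix_coefficient:
  "real_polynomial_function (\<lambda>A :: real^'n^'m. m \<bullet> (A *v x))"
proof (rule real_polynomial_function.intros(1))
  have "linear (\<lambda>A :: real^'n^'m. m \<bullet> (A *v x))"
    by (auto intro!: linearI simp: matrix_vector_mult_add_rdistrib inner_add_right scaleR_matrix_vector_assoc[symmetric])
  then show "bounded_linear (\<lambda>A :: real^'n^'m. m \<bullet> (A *v x))"
    by (simp add: linear_conv_bounded_linear)
qed

lemma zariski_dense_nonvanishing:
  assumes "A \<in> zariski_closure S" "real_polynomial_function p" "p A \<noteq> 0"
  obtains B where "B \<in> S" "p B \<noteq> 0"
  using assms unfolding zariski_closure_def by blast

lemma block_embed_nth: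
  "(block_embed g *v x) $ 1 = g $ 1 $ 1 * x $ 1 + g $ 1 $ 2 * x $ 2"
  "(block_embed g *v x) $ 2 = g $ 2 $ 1 * x $ 1 + g $ 2 $ 2 * x $ 2"
  "(block_embed g *v x) $ 3 = x $ 3"
  by (simp_all add: block_embed_def matrix_vector_mult_def sum_3)

lemma block_embed_transpose_axis_3: "transpose (block_embed g) *v axis 3 1 = axis 3 1"
  by (simp add: vec3_eq_iff block_embed_def matrix_vector_mult_def sum_3 transpose_def axis_def)

definition mat2 :: "real \<Rightarrow> real \<Rightarrow> real \<Rightarrow> real \<Rightarrow> real^2^2" where
  "mat2 p q r s = vector [vector [p, q], vector [r, s]]"

lemma mat2_nth: "mat2 p q r s $ 1 $ 1 = p" "mat2 p q r s $ 1 $ 2 = q" "mat2 p q r s $ 2 $ 1 = r" "mat2 p q r s $ 2 $ 2 = s"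
  by (simp_all add: mat2_def)

lemma det_mat2: "det (mat2 p q r s) = p * s - q * r"
  by (simp add: det_2 mat2_nth)

text \<open>
  The matrix sends \<open>u\<close> to \<open>t\<close> and the vector \<open>u\<close> turned by a right angle to a multiple of \<open>t\<close> turned by a right
  angle; the multiple \<open>N / T\<close> makes the determinant one.
\<close>
lemma SL2_transitive:
  fixes u1 u2 t1 t2 :: real
  assumes "u1 \<noteq> 0 \<or> u2 \<noteq> 0" "t1 \<noteq> 0 \<or> t2 \<noteq> 0"
  obtains p q r s where "p * s - q * r = 1" "p * u1 + q * u2 = t1" "r * u1 + s * u2 = t2"
proof -
  define N where "N = u1\<^sup>2 + u2\<^sup>2"
  define T where "T = t1\<^sup>2 + t2\<^sup>2"
  have nz: "N \<noteq> 0" "T \<noteq> 0" using assms by (auto simp: N_def T_def sum_power2_eq_zero_iff)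
  define p q r s where "p = t1 * u1 / N + t2 * u2 / T" and "q = t1 * u2 / N - t2 * u1 / T"
    and "r = t2 * u1 / N - t1 * u2 / T" and "s = t2 * u2 / N + t1 * u1 / T"
  have "p * s - q * r = (t1 * u1 / N + t2 * u2 / T) * (t2 * u2 / N + t1 * u1 / T)
      - (t1 * u2 / N - t2 * u1 / T) * (t2 * u1 / N - t1 * u2 / T)"
    by (simp add: p_def q_def r_def s_def)
  also have "\<dots> = (t1\<^sup>2 + t2\<^sup>2) * (u1\<^sup>2 + u2\<^sup>2) / (N * T)"
    using nz by (simp add: field_simps power2_eq_square)
  also have "\<dots> = 1" using nz by (simp add: N_def[symmetric] T_def[symmetric])
  finally have 1: "p * s - q * r = 1" .
  have "p * u1 + q * u2 = t1 * (u1\<^sup>2 + u2\<^sup>2) / N"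
    using nz by (simp add: p_def q_def field_simps power2_eq_square)
  then have 2: "p * u1 + q * u2 = t1" using nz(1) by (simp add: N_def[symmetric])
  have "r * u1 + s * u2 = t2 * (u1\<^sup>2 + u2\<^sup>2) / N"
    using nz by (simp add: r_def s_def field_simps power2_eq_square)
  then have 3: "r * u1 + s * u2 = t2" using nz(1) by (simp add: N_def[symmetric])
  show ?thesis using that[OF 1 2 3] .
qed

lemma direction_off_two_lines:
  fixes x1 x2 y1 y2 :: real
  assumes "x1 \<noteq> 0 \<or> x2 \<noteq> 0" "y1 \<noteq> 0 \<or> y2 \<noteq> 0"
  obtains t where "x1 * t - x2 \<noteq> 0" "y1 * t - y2 \<noteq> 0"
proof -
  obtain t where t: "t \<notin> {x2 / x1, y2 / y1}"
    using ex_new_if_finite[OF infinite_UNIV_char_0, of "{x2 / x1, y2 / y1}"] by auto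
  have "x1 * t - x2 \<noteq> 0" using t assms(1) by (cases "x1 = 0") (auto simp: field_simps)
  moreover have "y1 * t - y2 \<noteq> 0" using t assms(2) by (cases "y1 = 0") (auto simp: field_simps)
  ultimately show ?thesis by (rule that)
qed

definition planar_det :: "real^3 \<Rightarrow> real^3 \<Rightarrow> real" where
  "planar_det x y = x $ 1 * y $ 2 - x $ 2 * y $ 1"

text \<open>
  Density is used in the following form: a polynomial on matrices that is nonzero somewhere on the
  reducible copy of \<open>SL\<^sub>2(\<real>)\<close> is nonzero somewhere on \<open>\<Delta>\<close>.
\<close>
locale zariski_dense_in_reducible_SL2 =
  fixes \<Delta> :: "(real^3^3) set" and h :: "real^3^3"
  assumes det_h: "det h = 1"
    and subset: "\<Delta> \<subseteq> {h ** block_embed g ** matrix_inv h | g. det g = 1}"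
    and dense: "{h ** block_embed g ** matrix_inv h | g. det g = 1} \<subseteq> zariski_closure \<Delta>"
begin

lemma inverse_h [simp]: "h ** matrix_inv h = mat 1" "matrix_inv h ** h = mat 1"
  using det_h by (simp_all add: invertible_det_nz matrix_inv_invertible)

lemma conjugate_in_closure: "det g = 1 \<Longrightarrow> h ** block_embed g ** matrix_inv h \<in> zariski_closure \<Delta>"
  using dense by blast

lemma cancel_h [simp]: "h *v (matrix_inv h *v x) = x" "matrix_inv h *v (h *v x) = x"
  by (simp_all add: matrix_vector_mul_assoc)

text \<open>
  Coordinates in which the reducible copy becomes block-diagonal: the fixed line is the third axis and the
  invariant plane is spanned by the first two.
\<close>
definition coord :: "real^3 \<Rightarrow> real^3" where "coord x = matrix_inv h *v x"

lemma coord_h [simp]: "coord (h *v x) = x" by (simp add: coord_def)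

lemma coord_conjugate: "coord ((h ** A ** matrix_inv h) *v x) = A *v coord x"
  by (simp add: coord_def matrix_vector_mul_assoc matrix_mul_assoc)

lemma coord_eq_0_iff: "coord x = 0 \<longleftrightarrow> x = 0"
  unfolding coord_def by (metis cancel_h(1) matrix_vector_mult_0_right)

definition axis_vector :: "real^3" where "axis_vector = h *v axis 3 1"
definition plane_covector :: "real^3" where "plane_covector = transpose (matrix_inv h) *v axis 3 1"

lemma inner_transpose_inverse: "(transpose (matrix_inv h) *v m) \<bullet> x = m \<bullet> coord x"
  by (simp add: coord_def transpose_matrix_vector dot_lmul_matrix)

lemma plane_covector: "plane_covector \<bullet> x = coord x $ 3"
  by (simp add: plane_covector_def inner_transpose_inverse inner_axis')

lemma fixes_axis_vector: "\<delta> \<in> \<Delta> \<Longrightarrow> \<delta> *v axis_vector = axis_vector"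
proof -
  assume "\<delta> \<in> \<Delta>"
  then obtain g where "\<delta> = h ** block_embed g ** matrix_inv h" using subset by blast
  moreover have "block_embed g *v axis 3 1 = axis 3 1"
    by (simp add: vec3_eq_iff block_embed_nth axis_def)
  ultimately show ?thesis by (simp add: axis_vector_def matrix_vector_mul_assoc[symmetric])
qed

lemma fixes_plane_covector: "\<delta> \<in> \<Delta> \<Longrightarrow> transpose \<delta> *v plane_covector = plane_covector"
proof -
  assume "\<delta> \<in> \<Delta>"
  then obtain g where g: "\<delta> = h ** block_embed g ** matrix_inv h" using subset by blast
  have "transpose h *v (transpose (matrix_inv h) *v x) = x" for x
    by (simp add: matrix_vector_mul_assoc matrix_transpose_mul[symmetric] transpose_mat)
  with g show ?thesis
    by (simp add: plane_covector_def matrix_transpose_mul matrix_vector_mul_assoc[symmetric] block_embed_transpose_axis_3)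
qed

text \<open>
  Two matrix coefficients that do not vanish at some element of the reducible copy are simultaneously nonzero at some
  element of \<open>\<Delta>\<close>, because their product is a polynomial.
\<close>
lemma coefficient_nonvanishing:
  assumes "det g = 1" "m \<bullet> (block_embed g *v coord x) \<noteq> 0"
    "m' \<bullet> (block_embed g *v coord x) \<noteq> 0"
  obtains \<delta> where "\<delta> \<in> \<Delta>" "m \<bullet> coord (\<delta> *v x) \<noteq> 0" "m' \<bullet> coord (\<delta> *v x) \<noteq> 0"
proof -
  define A where "A = h ** block_embed g ** matrix_inv h"
  define p where "p B = ((transpose (matrix_inv h) *v m) \<bullet> (B *v x)) * ((transpose (matrix_inv h) *v m') \<bullet> (B *v x))"
    for B :: "real^3^3"
  have p: "p B = (m \<bullet> coord (B *v x)) * (m' \<bullet> coord (B *v x))" for B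
    by (simp add: p_def inner_transpose_inverse)
  have "A \<in> zariski_closure \<Delta>" unfolding A_def by (rule conjugate_in_closure[OF assms(1)])
  moreover have "real_polynomial_function p"
    unfolding p_def by (intro real_polynomial_function.intros(4) real_polynomial_matrix_coefficient)
  moreover have "p A \<noteq> 0" using assms(2,3) by (simp add: p A_def coord_conjugate)
  ultimately obtain B where "B \<in> \<Delta>" "p B \<noteq> 0" by (rule zariski_dense_nonvanishing)
  with that[of B] show ?thesis by (simp add: p)
qed

text \<open>
  On a finite \<open>\<Delta>\<close> a matrix coefficient \<open>f\<close> would satisfy the polynomial equation \<open>(\<Prod>C\<in>\<Delta>. f B - f C) = 0\<close>, hence take
  finitely many values on the whole reducible copy; but some coefficient separates the unipotent elements.
\<close>
lemma infinite: "infinite \<Delta>"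
proof
  assume fin: "finite \<Delta>"
  define m where "m = transpose (matrix_inv h) *v axis 1 1"
  define f where "f A = m \<bullet> (A *v (h *v axis 2 1))" for A :: "real^3^3"
  obtain t where t: "t \<notin> f ` \<Delta>"
    using ex_new_if_finite[OF infinite_UNIV_char_0 finite_imageI[OF fin, of f]] by blast
  define A where "A = h ** block_embed (mat2 1 t 0 1) ** matrix_inv h"
  define p where "p B = (\<Prod>C\<in>\<Delta>. f B - f C)" for B
  have "f A = (block_embed (mat2 1 t 0 1) *v axis 2 1) $ 1"
    by (simp add: f_def m_def inner_transpose_inverse A_def coord_conjugate inner_axis')
  then have "f A = t" by (simp add: block_embed_nth mat2_nth axis_def)
  then have "p A \<noteq> 0" using t fin by (auto simp: p_def)
  moreover have "real_polynomial_function p"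
    unfolding p_def f_def
    by (intro real_polynomial_function_prod fin real_polynomial_function_diff real_polynomial_matrix_coefficient
        real_polynomial_function.intros(2))
  moreover have "A \<in> zariski_closure \<Delta>"
    unfolding A_def by (rule conjugate_in_closure) (simp add: det_mat2)
  ultimately obtain B where B: "B \<in> \<Delta>" "p B \<noteq> 0"
    using zariski_dense_nonvanishing[of A \<Delta> p] by blast
  then show False using fin by (auto simp: p_def)
qed

lemma moves_off_two_lines:
  assumes x: "coord v \<noteq> 0" "coord v $ 3 = 0"
    and y: "y \<noteq> 0" "y $ 3 = 0" "z \<noteq> 0" "z $ 3 = 0"
  obtains \<delta> where "\<delta> \<in> \<Delta>" "planar_det y (coord (\<delta> *v v)) \<noteq> 0" "planar_det z (coord (\<delta> *v v)) \<noteq> 0"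
proof -
  have yz: "y $ 1 \<noteq> 0 \<or> y $ 2 \<noteq> 0" "z $ 1 \<noteq> 0 \<or> z $ 2 \<noteq> 0" "coord v $ 1 \<noteq> 0 \<or> coord v $ 2 \<noteq> 0"
    using x y by (auto simp: vec3_eq_iff)
  obtain t where t: "y $ 1 * t - y $ 2 \<noteq> 0" "z $ 1 * t - z $ 2 \<noteq> 0"
    using direction_off_two_lines[OF yz(1,2)] .
  obtain p q r s where *: "p * s - q * r = 1" "p * coord v $ 1 + q * coord v $ 2 = 1" "r * coord v $ 1 + s * coord v $ 2 = t"
    using SL2_transitive[OF yz(3), of 1 t] by (metis one_neq_zero)
  have pd: "planar_det w u = vector [- w $ 2, w $ 1, 0] \<bullet> u" for w u :: "real^3"
    by (simp add: planar_det_def inner_vec_def sum_3)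
  have "planar_det w (block_embed (mat2 p q r s) *v coord v) = w $ 1 * t - w $ 2" for w
    using * by (simp add: planar_det_def block_embed_nth mat2_nth)
  with t have "planar_det y (block_embed (mat2 p q r s) *v coord v) \<noteq> 0"
    "planar_det z (block_embed (mat2 p q r s) *v coord v) \<noteq> 0" by simp_all
  moreover have "det (mat2 p q r s) = 1" using * by (simp add: det_mat2)
  ultimately obtain \<delta> where "\<delta> \<in> \<Delta>" "planar_det y (coord (\<delta> *v v)) \<noteq> 0" "planar_det z (coord (\<delta> *v v)) \<noteq> 0"
    unfolding pd by (metis coefficient_nonvanishing)
  then show ?thesis by (rule that)
qed

text \<open>
  Any three vectors \<open>x\<close>, \<open>y\<close>, \<open>z\<close> of a plane satisfy \<open>det (y, z) x + det (z, x) y + det (x, y) z = 0\<close>; the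
  translates are chosen off the earlier lines so that all coefficients are nonzero.
\<close>
lemma three_dependent_translates:
  assumes "v \<noteq> 0" "plane_covector \<bullet> v = 0"
  obtains \<delta> \<delta>' a b c where "\<delta> \<in> \<Delta>" "\<delta>' \<in> \<Delta>"
    "a *\<^sub>R v + b *\<^sub>R (\<delta> *v v) + c *\<^sub>R (\<delta>' *v v) = 0" "a \<noteq> 0" "b \<noteq> 0" "c \<noteq> 0"
    "a = planar_det (coord (\<delta> *v v)) (coord (\<delta>' *v v))"
    "b = planar_det (coord (\<delta>' *v v)) (coord v)"
    "c = planar_det (coord v) (coord (\<delta> *v v))"
proof -
  define u where "u = coord v"
  have u: "u \<noteq> 0" "u $ 3 = 0" using assms by (simp_all add: u_def coord_eq_0_iff plane_covector)
  have planar: "coord (\<delta> *v v) $ 3 = 0" if "\<delta> \<in> \<Delta>" for \<delta>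
    using subset that u(2) by (auto simp: coord_conjugate block_embed_nth u_def)
  obtain \<delta> where \<delta>: "\<delta> \<in> \<Delta>" "planar_det u (coord (\<delta> *v v)) \<noteq> 0"
    using moves_off_two_lines[of v u u] u by (auto simp: u_def)
  define u' where "u' = coord (\<delta> *v v)"
  have u': "u' \<noteq> 0" "u' $ 3 = 0" using \<delta> planar by (auto simp: u'_def planar_det_def)
  obtain \<delta>' where \<delta>': "\<delta>' \<in> \<Delta>" "planar_det u (coord (\<delta>' *v v)) \<noteq> 0" "planar_det u' (coord (\<delta>' *v v)) \<noteq> 0"
    using moves_off_two_lines[of v u u'] u u' by (auto simp: u_def)
  define u'' where "u'' = coord (\<delta>' *v v)"
  have "u'' $ 3 = 0" using \<delta>' planar by (simp add: u''_def)
  then have "planar_det u' u'' *\<^sub>R u + planar_det u'' u *\<^sub>R u' + planar_det u u' *\<^sub>R u'' = 0"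
    using u u' by (simp add: vec3_eq_iff planar_det_def algebra_simps)
  then have "h *v (planar_det u' u'' *\<^sub>R u + planar_det u'' u *\<^sub>R u' + planar_det u u' *\<^sub>R u'') = 0" by simp
  then have "planar_det u' u'' *\<^sub>R v + planar_det u'' u *\<^sub>R (\<delta> *v v) + planar_det u u' *\<^sub>R (\<delta>' *v v) = 0"
    by (simp add: matrix_vector_right_distrib matrix_vector_mult_scaleR u_def u'_def u''_def coord_def)
  moreover have "planar_det u'' u = - planar_det u u''" by (simp add: planar_det_def)
  ultimately show ?thesis
    using that[OF \<delta>(1) \<delta>'(1)] \<delta>(2) \<delta>'(2,3) by (simp add: u_def u'_def u''_def)
qed

text \<open>
  The representation is the sum of an irreducible one and a trivial one, so an orbit confined to a plane
  starts on the fixed line or the plane is the invariant one. Five elements of \<open>SL\<^sub>2(\<real>)\<close> suffice to separate the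
  products of coordinates.
\<close>
lemma orbit_in_plane_cases:
  assumes m: "m \<noteq> 0" and z: "z \<noteq> 0" and vanish: "\<And>\<delta>. \<delta> \<in> \<Delta> \<Longrightarrow> m \<bullet> (\<delta> *v z) = 0"
  shows "(\<exists>r. z = r *\<^sub>R axis_vector) \<or> (\<exists>r. m = r *\<^sub>R plane_covector)"
proof -
  define n where "n = transpose h *v m"
  define y where "y = coord z"
  have mn: "m = transpose (matrix_inv h) *v n"
    by (simp add: n_def matrix_vector_mul_assoc matrix_transpose_mul[symmetric] transpose_mat)
  have *: "n \<bullet> (block_embed g *v y) = 0" if dg: "det g = 1" for g
  proof (rule ccontr)
    assume nz: "n \<bullet> (block_embed g *v y) \<noteq> 0"
    obtain \<delta> where "\<delta> \<in> \<Delta>" "n \<bullet> coord (\<delta> *v z) \<noteq> 0"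
      using coefficient_nonvanishing[OF dg, of n z n] nz unfolding y_def by blast
    then show False using vanish[of \<delta>] by (simp add: mn inner_transpose_inverse)
  qed
  have e: "n $ 1 * (p * y $ 1 + q * y $ 2) + n $ 2 * (r * y $ 1 + s * y $ 2) + n $ 3 * y $ 3 = 0"
    if "p * s - q * r = 1" for p q r s
    using *[of "mat2 p q r s"] that
    by (simp add: det_mat2 mat2_nth inner_vec_def sum_3 block_embed_nth)
  have E: "n $ 1 * y $ 1 + n $ 2 * y $ 2 + n $ 3 * y $ 3 = 0"
    "- n $ 1 * y $ 1 - n $ 2 * y $ 2 + n $ 3 * y $ 3 = 0"
    "n $ 1 * (2 * y $ 1) + n $ 2 * (y $ 2 / 2) + n $ 3 * y $ 3 = 0"
    "n $ 1 * y $ 2 - n $ 2 * y $ 1 + n $ 3 * y $ 3 = 0"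
    "n $ 1 * (2 * y $ 2) - n $ 2 * (y $ 1 / 2) + n $ 3 * y $ 3 = 0"
    using e[of 1 1 0 0] e[of "-1" "-1" 0 0] e[of 2 "1/2" 0 0] e[of 0 0 1 "-1"] e[of 0 0 2 "-1/2"]
    by simp_all
  have "n $ 3 * y $ 3 = 0" "n $ 1 * y $ 1 = 0" "n $ 2 * y $ 2 = 0" "n $ 1 * y $ 2 = 0" "n $ 2 * y $ 1 = 0"
    using E by linarith+
  then have "(n $ 3 = 0 \<or> y $ 3 = 0) \<and> ((n $ 1 = 0 \<and> n $ 2 = 0) \<or> (y $ 1 = 0 \<and> y $ 2 = 0))" by auto
  moreover have "y \<noteq> 0" using z by (simp add: y_def coord_eq_0_iff)
  moreover have "n \<noteq> 0" using m mn by auto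
  ultimately consider "y = y $ 3 *\<^sub>R axis 3 1" | "n = n $ 3 *\<^sub>R axis 3 1"
    by (auto simp: vec3_eq_iff axis_def)
  then show ?thesis
  proof cases
    case 1
    have "z = h *v y" by (simp add: y_def coord_def)
    then have "z = y $ 3 *\<^sub>R axis_vector"
      by (subst (asm) 1) (simp add: axis_vector_def matrix_vector_mult_scaleR)
    then show ?thesis by blast
  next
    case 2
    have "m = transpose (matrix_inv h) *v (n $ 3 *\<^sub>R axis 3 1)"
      by (simp only: 2[symmetric] mn[symmetric])
    then have "m = n $ 3 *\<^sub>R plane_covector"
      by (simp add: plane_covector_def matrix_vector_mult_scaleR)
    then show ?thesis by blast
  qed
qed

end

section \<open>Dense orbits of antipodal circle groups\<close>

locale antipodal_circle_group = zariski_dense_in_reducible_SL2 \<Delta> h for \<Delta> h +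
  fixes \<Gamma> :: "(real^3^3) set"
  assumes regular: "regular_subgroup \<Gamma>" and antip: "antipodal \<Gamma>"
    and circle: "topological_circle (subtopology flag_space (limit_set \<Gamma>))"
    and \<Delta>\<Gamma>: "\<Delta> \<subseteq> \<Gamma>"
begin

lemma subgroup: "subgroup \<Gamma> SL3"
  using regular by (simp add: regular_subgroup_def discrete_subgroup_def)

lemma inverse_action:
  assumes "\<gamma> \<in> \<Gamma>"
  shows "matrix_inv \<gamma> *v (\<gamma> *v x) = x"
proof -
  have "matrix_inv \<gamma> ** \<gamma> = mat 1"
    using subgroup_SL3D(1)[OF subgroup assms] by (simp add: invertible_det_nz matrix_inv_invertible)
  then show ?thesis by (simp add: matrix_vector_mul_assoc)
qed

lemma limit_set_flags: "F \<in> limit_set \<Gamma> \<Longrightarrow> F \<in> flags"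
  using limit_set_subset_flag_space topspace_flag_space by blast

lemma subspace_flag: "F \<in> flags \<Longrightarrow> subspace (fst F)" "F \<in> flags \<Longrightarrow> subspace (snd F)"
  by (auto simp: flags_def)

lemma limit_flags_eqI:
  assumes "X \<in> limit_set \<Gamma>" "Y \<in> limit_set \<Gamma>" "v \<in> fst X" "v \<noteq> 0" "v \<in> snd Y"
  shows "X = Y"
proof (rule ccontr)
  assume "X \<noteq> Y"
  then have "\<not> fst X \<subseteq> snd Y" using antip assms(1,2) by (auto simp: antipodal_def transverse_def)
  with flag_line_subset[of X v "snd Y"] assms limit_set_flags subspace_flag show False by blast
qed

text \<open>
  An injective sequence in \<open>\<Delta>\<close> fixes the axis and preserves the plane, so it has a limit flag with line in the
  invariant plane and plane through the axis. The translates of this line by elements of \<open>\<Delta>\<close> are lines of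
  limit flags as well.
\<close>
lemma three_limit_flags:
  obtains v1 v2 v3 X1 X2 X3 a b c where
    "X1 \<in> limit_set \<Gamma>" "X2 \<in> limit_set \<Gamma>" "X3 \<in> limit_set \<Gamma>" "X1 \<noteq> X2" "X1 \<noteq> X3" "X2 \<noteq> X3"
    "v1 \<in> fst X1" "v2 \<in> fst X2" "v3 \<in> fst X3" "v1 \<noteq> 0" "v2 \<noteq> 0" "v3 \<noteq> 0"
    "a *\<^sub>R v1 + b *\<^sub>R v2 + c *\<^sub>R v3 = 0" "a \<noteq> 0" "b \<noteq> 0" "c \<noteq> 0"
    "axis_vector \<in> snd X1" "plane_covector \<bullet> v1 = 0" "plane_covector \<bullet> v2 = 0"
proof -
  obtain \<gamma> :: "nat \<Rightarrow> real^3^3" where \<gamma>: "inj \<gamma>" "range \<gamma> \<subseteq> \<Delta>"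
    using infinite infinite_countable_subset by blast
  have mem: "\<gamma> j \<in> \<Delta>" for j using \<gamma>(2) by blast
  obtain v X where v: "v \<noteq> 0" "plane_covector \<bullet> v = 0" and X: "X \<in> limit_set \<Gamma>" "v \<in> fst X" "axis_vector \<in> snd X"
    and orb: "\<forall>\<delta>\<in>\<Gamma>. \<exists>Y\<in>limit_set \<Gamma>. \<delta> *v v \<in> fst Y"
    by (rule invariant_limit_flag[OF regular subset_trans[OF \<gamma>(2) \<Delta>\<Gamma>] \<gamma>(1)
          fixes_axis_vector[OF mem] fixes_plane_covector[OF mem]])
  obtain \<delta> \<delta>' a b c where \<delta>: "\<delta> \<in> \<Delta>" "\<delta>' \<in> \<Delta>"
    and rel: "a *\<^sub>R v + b *\<^sub>R (\<delta> *v v) + c *\<^sub>R (\<delta>' *v v) = 0" "a \<noteq> 0" "b \<noteq> 0" "c \<noteq> 0"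
    and abc: "a = planar_det (coord (\<delta> *v v)) (coord (\<delta>' *v v))"
      "b = planar_det (coord (\<delta>' *v v)) (coord v)" "c = planar_det (coord v) (coord (\<delta> *v v))"
    by (rule three_dependent_translates[OF v])
  obtain Y Y' where Y: "Y \<in> limit_set \<Gamma>" "\<delta> *v v \<in> fst Y" "Y' \<in> limit_set \<Gamma>" "\<delta>' *v v \<in> fst Y'"
    using orb \<delta> \<Delta>\<Gamma> by blast
  have nz: "\<delta> *v v \<noteq> 0" "\<delta>' *v v \<noteq> 0"
    using v(1) inverse_action \<delta> \<Delta>\<Gamma> by (metis matrix_vector_mult_0_right subsetD)+
  have ne: "F \<noteq> G" if F: "F \<in> limit_set \<Gamma>" "x \<in> fst F" and G: "y \<in> fst G" "y \<noteq> 0"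
    and d: "planar_det (coord x) (coord y) \<noteq> 0" for F G x y
  proof
    assume "F = G"
    then have "fst F \<subseteq> span {y}"
      using F G limit_set_flags by (intro flag_line_subset[of F y]) (auto simp: span_base)
    then obtain r where "x = r *\<^sub>R y" using F(2) by (auto simp: span_singleton)
    then have "coord x = r *\<^sub>R coord y" by (simp add: coord_def matrix_vector_mult_scaleR)
    with d show False by (simp add: planar_det_def)
  qed
  have "plane_covector \<bullet> (\<delta> *v v) = (transpose \<delta> *v plane_covector) \<bullet> v"
    by (simp add: transpose_matrix_vector dot_lmul_matrix)
  then have "plane_covector \<bullet> (\<delta> *v v) = 0" using v(2) fixes_plane_covector[OF \<delta>(1)] by simp
  moreover have "X \<noteq> Y" "Y \<noteq> Y'" "Y' \<noteq> X"
    using ne[OF X(1,2) Y(2) nz(1)] ne[OF Y(1,2) Y(4) nz(2)] ne[OF Y(3,4) X(2) v(1)] rel(2-4) abc by auto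
  ultimately show ?thesis
    using that[OF X(1) Y(1) Y(3) _ _ _ X(2) Y(2) Y(4) v(1) nz rel X(3) v(2)] by auto
qed

lemma limit_planes_cover: "\<exists>F\<in>limit_set \<Gamma>. p \<in> snd F"
proof (rule three_limit_flags, goal_cases)
  case (1 X1 X2 X3 v1 v2 v3 a b c)
  show ?case
    using antip unfolding antipodal_def
    by (intro dependent_antipodal_circle_planes_cover[OF circle limit_set_subset_flag_space _ 1(1-16)]) blast
qed

text \<open>
  Otherwise \<open>Z\<close> has the axis as its line, or \<open>Y\<close> has the invariant plane as its plane. Either case contradicts antipodality:
  the axis is on the plane of \<open>X1\<close>, and the invariant plane contains the lines of \<open>X1\<close> and \<open>X2\<close>.
\<close>
lemma limit_line_moves_off_limit_plane:
  assumes Y: "Y \<in> limit_set \<Gamma>" and Z: "Z \<in> limit_set \<Gamma>" and z: "z \<in> fst Z" "z \<noteq> 0"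
    and m: "m \<noteq> 0" "snd Y = {x. m \<bullet> x = 0}"
  shows "\<exists>\<delta>\<in>\<Delta>. m \<bullet> (\<delta> *v z) \<noteq> 0"
proof (rule ccontr)
  assume "\<not> ?thesis"
  then have dichotomy: "(\<exists>r. z = r *\<^sub>R axis_vector) \<or> (\<exists>r. m = r *\<^sub>R plane_covector)"
    by (intro orbit_in_plane_cases[OF m(1) z(2)]) auto
  obtain v1 v2 v3 X1 X2 X3 a b c where X: "X1 \<in> limit_set \<Gamma>" "X2 \<in> limit_set \<Gamma>" "X1 \<noteq> X2"
    "v1 \<in> fst X1" "v2 \<in> fst X2" "v1 \<noteq> 0" "v2 \<noteq> 0"
    "axis_vector \<in> snd X1" "plane_covector \<bullet> v1 = 0" "plane_covector \<bullet> v2 = 0"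
    by (rule three_limit_flags)
  from dichotomy show False
  proof (elim disjE exE)
    fix r assume r: "z = r *\<^sub>R axis_vector"
    then have "z \<in> snd X1"
      using X(8) subspace_flag(2)[OF limit_set_flags[OF X(1)]] by (simp add: subspace_scale)
    then have "Z = X1" by (rule limit_flags_eqI[OF Z X(1) z])
    then have "fst Z \<subseteq> span {v1}"
      using X(1,4,6) limit_set_flags by (intro flag_line_subset[of Z v1]) (auto simp: span_base)
    then obtain s where "z = s *\<^sub>R v1" using z(1) by (auto simp: span_singleton)
    then have "plane_covector \<bullet> z = 0" by (simp add: X(9))
    moreover have "plane_covector \<bullet> z = r"
      by (simp add: r plane_covector axis_vector_def matrix_vector_mult_scaleR[symmetric])
    ultimately show False using r z(2) by simp
  next
    fix r assume r: "m = r *\<^sub>R plane_covector"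
    then have "v1 \<in> snd Y" "v2 \<in> snd Y" using X(9,10) by (simp_all add: m(2))
    then have "X1 = Y" "X2 = Y" using limit_flags_eqI X Y by blast+
    then show False using X(3) by simp
  qed
qed

text \<open>
  An open cone meets some limit plane by the cover, so its closure swallows the repelling plane of a sequence, then a
  translate of it in general position, and then every limit plane as the limit of images of that translate.
\<close>
lemma invariant_open_cone_dense:
  assumes W: "open W" "W \<noteq> {}" and scale: "\<And>x r. x \<in> W \<Longrightarrow> r \<noteq> 0 \<Longrightarrow> r *\<^sub>R x \<in> W"
    and inv: "\<And>\<gamma> x. \<gamma> \<in> \<Gamma> \<Longrightarrow> x \<in> W \<Longrightarrow> \<gamma> *v x \<in> W"
  shows "closure W = UNIV"
proof -
  have pull_back: "x \<in> W" if "\<gamma> \<in> \<Gamma>" "\<gamma> *v x \<in> W" for \<gamma> x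
    using inv[OF subgroup_SL3D(3)[OF subgroup that(1)] that(2)] by (simp add: inverse_action that(1))
  have cl: "\<gamma> *v x \<in> closure W" if \<gamma>: "\<gamma> \<in> \<Gamma>" and x: "x \<in> closure W" for \<gamma> x
  proof -
    obtain y where y: "\<And>n. y n \<in> W" "y \<longlonglongrightarrow> x"
      using x closure_sequential[of x W] by auto
    have "(\<lambda>n. \<gamma> *v y n) \<longlonglongrightarrow> \<gamma> *v x" by (intro tendsto_intros y)
    with y(1) inv[OF \<gamma>] show ?thesis
      unfolding closure_sequential by (intro exI[of _ "\<lambda>n. \<gamma> *v y n"]) auto
  qed
  obtain u where u: "u \<in> W" using W(2) by blast
  obtain F where F: "F \<in> limit_set \<Gamma>" "u \<in> snd F" using limit_planes_cover by blast
  obtain g k k' a b c l l' where C: "cartan_limit g k k' a b c l l'" and g: "range g \<subseteq> \<Gamma>"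
    and att: "snd (cartan_limit.attracting l) = snd F" and Y: "cartan_limit.repelling l' \<in> limit_set \<Gamma>"
    using limit_set_cartan_limit[OF regular F(1)] by metis
  define Y where "Y = cartan_limit.repelling l'"
  have YC: "snd Y \<subseteq> closure W"
    unfolding Y_def
  proof (rule cartan_limit.repelling_plane_subset_closure[OF C W(1) scale _ u])
    show "x \<in> W" if "g j *v x \<in> W" for j x using pull_back[OF _ that] g by blast
    show "u \<in> snd (cartan_limit.attracting l)" using F(2) att by simp
  qed
  have YL: "Y \<in> limit_set \<Gamma>" using Y by (simp add: Y_def)
  obtain m where m: "m \<noteq> 0" "snd Y = {x. m \<bullet> x = 0}"
    using flag_plane_normal[of Y] YL limit_set_subset_flag_space by blast
  have "x \<in> closure W" for x
  proof -
    obtain F' where F': "F' \<in> limit_set \<Gamma>" "x \<in> snd F'" using limit_planes_cover by blast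
    obtain g k k' a b c l l' where C: "cartan_limit g k k' a b c l l'" and g: "range g \<subseteq> \<Gamma>"
      and att: "snd (cartan_limit.attracting l) = snd F'" and Z: "cartan_limit.repelling l' \<in> limit_set \<Gamma>"
      using limit_set_cartan_limit[OF regular F'(1)] by metis
    define Z where "Z = cartan_limit.repelling l'"
    have ZL: "Z \<in> limit_set \<Gamma>" using Z by (simp add: Z_def)
    then have "Z \<in> flags" by (rule limit_set_flags)
    then have "dim (fst Z) = 1" unfolding flags_def by force
    then have "\<not> fst Z \<subseteq> {0}" using dim_eq_0[of "fst Z"] by simp
    then obtain z where z: "z \<in> fst Z" "z \<noteq> 0" by blast
    obtain \<delta> where \<delta>: "\<delta> \<in> \<Delta>" "m \<bullet> (\<delta> *v z) \<noteq> 0"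
      using limit_line_moves_off_limit_plane[OF YL ZL z m] by blast
    then have \<delta>\<Gamma>: "\<delta> \<in> \<Gamma>" using \<Delta>\<Gamma> by blast
    have tr: "(transpose \<delta> *v m) \<bullet> y = m \<bullet> (\<delta> *v y)" for y
      by (simp add: transpose_matrix_vector dot_lmul_matrix)
    have "{y. (transpose \<delta> *v m) \<bullet> y = 0} \<subseteq> closure W"
    proof
      fix y assume "y \<in> {y. (transpose \<delta> *v m) \<bullet> y = 0}"
      then have "\<delta> *v y \<in> closure W" using YC m(2) by (auto simp: tr)
      then show "y \<in> closure W"
        using cl[OF subgroup_SL3D(3)[OF subgroup \<delta>\<Gamma>]] inverse_action[OF \<delta>\<Gamma>] by metis
    qed
    moreover have "g j *v y \<in> closure W" if "y \<in> closure W" for j y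
      using cl[OF _ that] g by blast
    ultimately have "snd (cartan_limit.attracting l) \<subseteq> closure W"
      using z \<delta>(2) unfolding Z_def
      by (intro cartan_limit.attracting_plane_subset_closed[OF C closed_closure, of W "transpose \<delta> *v m" z])
        (auto simp: tr)
    with F'(2) att show ?thesis by blast
  qed
  then show ?thesis by blast
qed

text \<open>
  Baire's theorem for the open dense cones \<open>W U\<close> of vectors whose projective orbit meets \<open>U\<close>, where \<open>U\<close> ranges over a countable
  basis of \<open>\<real>\<^sup>3\<close>.
\<close>
theorem dense_orbit_RP2: "\<exists>L\<in>topspace RP2. RP2 closure_of (orbit_RP2 \<Gamma> L) = topspace RP2"
proof -
  obtain B :: "(real^3) set set" where B: "countable B" "topological_basis B"
    using ex_countable_basis by blast
  define W where "W U = (\<Union>\<gamma>\<in>\<Gamma>. \<Union>r\<in>-{0}. {x. r *\<^sub>R (\<gamma> *v x) \<in> U})" for U :: "(real^3) set"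
  have W_I: "x \<in> W U" if "\<gamma> \<in> \<Gamma>" "r \<noteq> 0" "r *\<^sub>R (\<gamma> *v x) \<in> U" for \<gamma> r x U
    using that unfolding W_def by blast
  have W: "open (W U) \<and> closure (W U) = UNIV" if U: "U \<in> B - {{}}" for U
  proof
    have "open U" using U B(2) topological_basis_open by blast
    moreover have "continuous_on UNIV (\<lambda>x. r *\<^sub>R (\<gamma> *v x))" for r :: real and \<gamma> :: "real^3^3"
      by (intro continuous_intros)
    ultimately have "open ((\<lambda>x. r *\<^sub>R (\<gamma> *v x)) -` U)" for r :: real and \<gamma> :: "real^3^3"
      by (metis open_vimage)
    then show op: "open (W U)" unfolding W_def vimage_def by blast
    show "closure (W U) = UNIV"
    proof (rule invariant_open_cone_dense[OF op])
      obtain x where "x \<in> U" using U by blast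
      then have "1 *\<^sub>R (mat 1 *v x) \<in> U" by simp
      then have "x \<in> W U" using subgroup_SL3D(4)[OF subgroup] W_I[of "mat 1" 1] by simp
      then show "W U \<noteq> {}" by blast
    next
      fix x and s :: real assume "x \<in> W U" "s \<noteq> 0"
      then obtain \<gamma> r where "\<gamma> \<in> \<Gamma>" "r \<noteq> 0" "r *\<^sub>R (\<gamma> *v x) \<in> U" by (auto simp: W_def)
      then have "(r / s) *\<^sub>R (\<gamma> *v (s *\<^sub>R x)) \<in> U" "r / s \<noteq> 0"
        using \<open>s \<noteq> 0\<close> by (simp_all add: matrix_vector_mult_scaleR)
      with \<open>\<gamma> \<in> \<Gamma>\<close> show "s *\<^sub>R x \<in> W U" by (intro W_I)
    next
      fix \<beta> x assume \<beta>: "\<beta> \<in> \<Gamma>" and "x \<in> W U"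
      then obtain \<gamma> r where \<gamma>: "\<gamma> \<in> \<Gamma>" "r \<noteq> 0" "r *\<^sub>R (\<gamma> *v x) \<in> U" by (auto simp: W_def)
      have "\<gamma> ** matrix_inv \<beta> \<in> \<Gamma>" using subgroup_SL3D[OF subgroup] \<beta> \<gamma>(1) by blast
      moreover have "r *\<^sub>R ((\<gamma> ** matrix_inv \<beta>) *v (\<beta> *v x)) \<in> U"
        using \<gamma>(3) inverse_action[OF \<beta>] by (simp add: matrix_vector_mul_assoc[symmetric])
      ultimately show "\<beta> *v x \<in> W U" using \<gamma>(2) by (intro W_I)
    qed
  qed
  have "UNIV \<subseteq> closure (\<Inter>(W ` (B - {{}})))"
    using B(1) W by (intro Baire) auto
  then have "\<not> \<Inter>(W ` (B - {{}})) \<subseteq> {0}"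
    using closure_minimal[of "\<Inter>(W ` (B - {{}}))" "{0}"] one_neq_zero[where 'a="real^3"] by blast
  then obtain v where v: "v \<noteq> 0" "\<And>U. U \<in> B \<Longrightarrow> U \<noteq> {} \<Longrightarrow> v \<in> W U" by blast
  have "RP2 closure_of (orbit_RP2 \<Gamma> (span {v})) = topspace RP2"
    unfolding dense_intersects_open
  proof (intro allI impI)
    fix T assume T: "openin RP2 T \<and> T \<noteq> {}"
    define T' where "T' = {w \<in> UNIV - {0}. span {w} \<in> T}"
    have T_image: "T \<subseteq> (\<lambda>w. span {w}) ` (UNIV - {0})" and "openin (top_of_set (UNIV - {0})) T'"
      using T by (simp_all add: RP2_def openin_quotient_topology T'_def)
    then have "open T'" by (simp add: openin_open_eq open_delete)
    moreover obtain w where "w \<in> T'" using T T_image by (auto simp: T'_def)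
    ultimately obtain U where U: "U \<in> B" "w \<in> U" "U \<subseteq> T'"
      using topological_basisE[OF B(2)] by metis
    then obtain \<gamma> r where \<gamma>: "\<gamma> \<in> \<Gamma>" "r \<noteq> 0" "r *\<^sub>R (\<gamma> *v v) \<in> U"
      using v(2)[of U] by (auto simp: W_def)
    have "span {r *\<^sub>R (\<gamma> *v v)} = span {\<gamma> *v v}" 
      using \<gamma>(2) span_image_scale[of "{\<gamma> *v v}" "\<lambda>_. r"] by simp
    also have "\<dots> = (*v) \<gamma> ` span {v}"
      using span_linear_image[of "(*v) \<gamma>" "{v}"] by simp
    finally have "span {r *\<^sub>R (\<gamma> *v v)} \<in> orbit_RP2 \<Gamma> (span {v})"
      using \<gamma>(1) by (auto simp: orbit_RP2_def)
    moreover have "span {r *\<^sub>R (\<gamma> *v v)} \<in> T" using U(3) \<gamma>(3) by (auto simp: T'_def)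
    ultimately show "orbit_RP2 \<Gamma> (span {v}) \<inter> T \<noteq> {}" by blast
  qed
  moreover have "span {v} \<in> topspace RP2"
    using v(1) by (simp add: topspace_RP2 dim_eq_card_independent)
  ultimately show ?thesis by blast
qed

end

theorem proposition6:
  fixes \<Gamma> H :: "(real^3^3) set"
  assumes "regular_subgroup \<Gamma>"
    and "antipodal \<Gamma>"
    and "topological_circle (subtopology flag_space (limit_set \<Gamma>))"
    and "reducible_SL2 H"
    and "zariski_closure (\<Gamma> \<inter> H) = H"
  shows "\<exists>L\<in>topspace RP2. RP2 closure_of (orbit_RP2 \<Gamma> L) = topspace RP2"
proof -
  obtain h where h: "h \<in> carrier SL3" "H = {h ** block_embed g ** matrix_inv h | g. det g = 1}"
    using assms(4) by (auto simp: reducible_SL2_def)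
  interpret antipodal_circle_group "\<Gamma> \<inter> H" h \<Gamma>
  proof
    show "det h = 1" using h(1) by (simp add: SL3_def)
    show "\<Gamma> \<inter> H \<subseteq> {h ** block_embed g ** matrix_inv h | g. det g = 1}" using h(2) by blast
    show "{h ** block_embed g ** matrix_inv h | g. det g = 1} \<subseteq> zariski_closure (\<Gamma> \<inter> H)"
      using h(2) assms(5) by simp
  qed (use assms in auto)
  show ?thesis by (rule dense_orbit_RP2)
qed

end
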